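(* Let $\Omega\subset[0,1]^d$ be compact and let $\delta>0$. (Continuous case.) For the pair $(A,Z)=(A^{\mathbf p}_{\mathbf N},Z^{\mathbf p}_{\mathbf N})$, the matrix $A-AZ^*A$ has 1. at most $\#K^{\mathbf p}_{\mathbf N}(\Omega)$ non-zero columns; 2. $\mathrm{rank}(A-AZ^*A)\le\#K^{\mathbf p}_{\mathbf N}(\Omega)$; 3. $\mathcal O(\#K^{\mathbf p}_{\mathbf N}(\Omega))$ rows with elements larger than $\delta$ in absolute value; and 4. $\mathcal O(\#K^{\mathbf p}_{\mathbf N}(\Omega))$ elements larger than $\delta$ in absolute value. (Discrete case.) For the pair $(A,Z)=(A^{\mathbf q}_{\mathbf N},Z^{\mathbf q}_{\mathbf N})$, the matrix $A-AZ^*A$ has 1. at most $\#K^{\mathbf p,\mathbf q}_{\mathbf N}(\Omega)$ non-zero columns; 2. $\mathrm{rank}(A-AZ^*A)\le\#K^{\mathbf p,\mathbf q}_{\mathbf N}(\Omega)$; 3. $\mathcal O(\#K^{\mathbf p,\mathbf q}_{\mathbf N}(\Omega))$ rows with elements larger than $\delta$ in absolute value; and 4. $\mathcal O(\#K^{\mathbf p,\mathbf q}_{\mathbf N}(\Omega))$ elements larger than $\delta$ in absolute value. The constants in the $\mathcal O$ are independent of $N$.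
   Context: B-splines: $\beta^0(t)=1$ for $t\in[-\tfrac12,\tfrac12)$ and $0$ otherwise, $\beta^p=\beta^{p-1}\star\beta^0$ for $p\ge1$. Univariate periodic bases: for $N\ge1$, $\phi^p_N(t)=\sum_{l\in\mathbb{Z}}N^{1/2}\beta^p(N(t-l))$, $\phi^p_{N,k}(t)=\phi^p_N(t-\tfrac kN)$ for $k=0,\dots,N-1$, and $V^p_N=\mathrm{span}\{\phi^p_{N,k}\}_{k=0}^{N-1}$, a space of 1-periodic functions. The continuous dual basis $\{\tilde\phi^p_{N,k}\}_{k=0}^{N-1}\subset V^p_N$ is the unique one with $(\phi^p_{N,k},\tilde\phi^p_{N,l})_{L^2(0,1)}=\delta_{k,l}$. For the discrete setting with integer oversampling factor $q$, put $\phi^{p,q}_{N,k}=N^{-1/2}\phi^p_{N,k}$ and $\langle f,g\rangle_{N,q}=\sum_{k=0}^{Nq-1}f(\tfrac{k}{qN})\overline{g(\tfrac{k}{qN})}$; the discrete dual basis $\{\tilde\phi^{p,q}_{N,k}\}_{k=0}^{N-1}\subset V^p_N$ is the unique one with $\langle\phi^{p,q}_{N,k},\tilde\phi^{p,q}_{N,l}\rangle_{N,q}=\delta_{k,l}$ (the parameters $p,q$ are assumed to be such that it exists). Multivariate: $\mathbf p=(p_1,\dots,p_d)$, $\mathbf q=(q_1,\dots,q_d)$, $\mathbf N=(N_1,\dots,N_d)$, $N=\prod_iN_i$, $I_{\mathbf N}=\{(n_1,\dots,n_d): 0\le n_i\le N_i-1\}$. The functions $\phi^{\mathbf p}_{\mathbf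 N,\mathbf k},\tilde\phi^{\mathbf p}_{\mathbf N,\mathbf k},\phi^{\mathbf p,\mathbf q}_{\mathbf N,\mathbf k},\tilde\phi^{\mathbf p,\mathbf q}_{\mathbf N,\mathbf k}$, $\mathbf k\in I_{\mathbf N}$, are the tensor products of the corresponding univariate functions, considered on $[0,1]^d$. The parameters $d,\mathbf p,\mathbf q,\Omega,\delta$ are fixed as $\mathbf N$ varies. Continuous pair: $A^{\mathbf p}_{\mathbf N}(\mathbf k,\mathbf l)=(\phi^{\mathbf p}_{\mathbf N,\mathbf k},\phi^{\mathbf p}_{\mathbf N,\mathbf l})_{L^2(\Omega)}$ and $Z^{\mathbf p}_{\mathbf N}(\mathbf k,\mathbf l)=(\tilde\phi^{\mathbf p}_{\mathbf N,\mathbf k},\tilde\phi^{\mathbf p}_{\mathbf N,\mathbf l})_{L^2([0,1]^d)}$, $\mathbf k,\mathbf l\in I_{\mathbf N}$. Discrete pair: let $P^{\mathbf q}_{\mathbf N}=\{(\tfrac{k_1}{q_1N_1},\dots,\tfrac{k_d}{q_dN_d}):0\le k_i\le N_iq_i-1\}$ and let $\mathbf t_0,\dots,\mathbf t_{M-1}$ be an enumeration of $P^{\mathbf q}_{\mathbf N}\cap\Omega$. Then $A^{\mathbf q}_{\mathbf N}(m,\mathbf l)=\phi^{\mathbf p,\mathbf q}_{\mathbf N,\mathbf l}(\mathbf t_m)$ and $Z^{\mathbf q}_{\mathbf N}(m,\mathbf l)=\tilde\phi^{\mathbf p,\mathbf q}_{\mathbf N,\mathbf l}(\mathbf t_m)$,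 for $0\le m\le M-1$, $\mathbf l\in I_{\mathbf N}$. Boundary index sets: with $\Omega^c=[0,1]^d\setminus\Omega$, $$K^{\mathbf p}_{\mathbf N}(\Omega)=\{\mathbf l\in I_{\mathbf N}:\ \mathrm{supp}\,\phi^{\mathbf p}_{\mathbf N,\mathbf l}\cap\Omega\ne\varnothing\text{ and }\mathrm{supp}\,\phi^{\mathbf p}_{\mathbf N,\mathbf l}\cap\Omega^c\ne\varnothing\},$$ and $K^{\mathbf p,\mathbf q}_{\mathbf N}(\Omega)$ is defined in the same way with $\mathrm{supp}\,\phi^{\mathbf p}_{\mathbf N,\mathbf l}$ replaced by the discrete support $\mathrm{supp}_{\mathbf q}\,\phi^{\mathbf p,\mathbf q}_{\mathbf N,\mathbf l}=\mathrm{supp}\,\phi^{\mathbf p,\mathbf q}_{\mathbf N,\mathbf l}\cap P^{\mathbf q}_{\mathbf N}$. Here $\#$ denotes cardinality and $Z^*$ the conjugate transpose. *)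

theory Defs
  imports
    "HOL-Analysis.Analysis"
    "Jordan_Normal_Form.Schur_Decomposition"
    "Jordan_Normal_Form.DL_Rank"
begin

(* Both the Analysis and the Jordan_Normal_Form vectors use the infix dollar sign. *)
no_notation Matrix.vec_index (infixl \<open>$\<close> 100)
notation Finite_Cartesian_Product.vec_nth (infixl \<open>$\<close> 90)

definition convolution :: "(real \<Rightarrow> real) \<Rightarrow> (real \<Rightarrow> real) \<Rightarrow> real \<Rightarrow> real" where
  "convolution f g t = (LINT s|lborel. f s * g (t - s))"

definition bspline0 :: "real \<Rightarrow> real" where
  "bspline0 = indicator {-1/2..<1/2}"

primrec bspline :: "nat \<Rightarrow> real \<Rightarrow> real" where
  "bspline 0 = bspline0"
| "bspline (Suc p) = convolution (bspline p) bspline0"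

definition periodic_bspline :: "nat \<Rightarrow> nat \<Rightarrow> real \<Rightarrow> real" where
  "periodic_bspline p n t =
     (\<Sum>\<^sub>\<infinity>l\<in>(UNIV :: int set). sqrt (real n) * bspline p (real n * (t - of_int l)))"

text \<open>The basis functions are real-valued, but spans, inner products and matrices are complex.\<close>

definition phi :: "nat \<Rightarrow> nat \<Rightarrow> nat \<Rightarrow> real \<Rightarrow> complex" where
  "phi p n k t = complex_of_real (periodic_bspline p n (t - real k / real n))"

definition spline_space :: "nat \<Rightarrow> nat \<Rightarrow> (real \<Rightarrow> complex) set" where
  "spline_space p n = {(\<lambda>t. \<Sum>k<n. c k * phi p n k t) | c. True}"

definition L2_inner :: "'a::euclidean_space set \<Rightarrow> ('a \<Rightarrow> complex) \<Rightarrow> ('a \<Rightarrow> complex) \<Rightarrow> complex" where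
  "L2_inner S f g = (LINT t:S|lborel. f t * cnj (g t))"

definition phi_dual :: "nat \<Rightarrow> nat \<Rightarrow> nat \<Rightarrow> real \<Rightarrow> complex" where
  "phi_dual p n l = (THE \<psi>. \<psi> \<in> spline_space p n \<and>
     (\<forall>k<n. L2_inner {0<..<1} (phi p n k) \<psi> = (if k = l then 1 else 0)))"

definition discrete_inner ::
    "nat \<Rightarrow> nat \<Rightarrow> (real \<Rightarrow> complex) \<Rightarrow> (real \<Rightarrow> complex) \<Rightarrow> complex" where
  "discrete_inner n q f g =
     (\<Sum>k<n * q. f (real k / (real q * real n)) * cnj (g (real k / (real q * real n))))"

text \<open>The discretely normalized basis does not depend on the oversampling factor; its dual does.\<close>

definition phi_discrete :: "nat \<Rightarrow> nat \<Rightarrow> nat \<Rightarrow> real \<Rightarrow> complex" where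
  "phi_discrete p n k t = phi p n k t / complex_of_real (sqrt (real n))"

definition is_discrete_dual :: "nat \<Rightarrow> nat \<Rightarrow> nat \<Rightarrow> nat \<Rightarrow> (real \<Rightarrow> complex) \<Rightarrow> bool" where
  "is_discrete_dual p q n l \<psi> \<longleftrightarrow> \<psi> \<in> spline_space p n \<and>
     (\<forall>k<n. discrete_inner n q (phi_discrete p n k) \<psi> = (if k = l then 1 else 0))"

definition discrete_dual_exists :: "nat \<Rightarrow> nat \<Rightarrow> bool" where
  "discrete_dual_exists p q \<longleftrightarrow> (\<forall>n\<ge>1. \<forall>l<n. \<exists>!\<psi>. is_discrete_dual p q n l \<psi>)"

definition phi_discrete_dual :: "nat \<Rightarrow> nat \<Rightarrow> nat \<Rightarrow> nat \<Rightarrow> real \<Rightarrow> complex" where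
  "phi_discrete_dual p q n l = (THE \<psi>. is_discrete_dual p q n l \<psi>)"

text \<open>
  The dimension is the cardinality of the index type; multi-indices and the parameters
  are functions on it.
\<close>

definition tensor :: "('d::finite \<Rightarrow> real \<Rightarrow> complex) \<Rightarrow> real^'d \<Rightarrow> complex" where
  "tensor f t = (\<Prod>i\<in>UNIV. f i (t $ i))"

definition Phi :: "('d::finite \<Rightarrow> nat) \<Rightarrow> ('d \<Rightarrow> nat) \<Rightarrow> ('d \<Rightarrow> nat) \<Rightarrow> real^'d \<Rightarrow> complex" where
  "Phi p N k = tensor (\<lambda>i. phi (p i) (N i) (k i))"

definition Phi_dual :: "('d::finite \<Rightarrow> nat) \<Rightarrow> ('d \<Rightarrow> nat) \<Rightarrow> ('d \<Rightarrow> nat) \<Rightarrow> real^'d \<Rightarrow> complex" where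
  "Phi_dual p N k = tensor (\<lambda>i. phi_dual (p i) (N i) (k i))"

definition Phi_discrete ::
    "('d::finite \<Rightarrow> nat) \<Rightarrow> ('d \<Rightarrow> nat) \<Rightarrow> ('d \<Rightarrow> nat) \<Rightarrow> real^'d \<Rightarrow> complex" where
  "Phi_discrete p N k = tensor (\<lambda>i. phi_discrete (p i) (N i) (k i))"

definition Phi_discrete_dual ::
    "('d::finite \<Rightarrow> nat) \<Rightarrow> ('d \<Rightarrow> nat) \<Rightarrow> ('d \<Rightarrow> nat) \<Rightarrow> ('d \<Rightarrow> nat) \<Rightarrow> real^'d \<Rightarrow> complex" where
  "Phi_discrete_dual p q N k = tensor (\<lambda>i. phi_discrete_dual (p i) (q i) (N i) (k i))"

definition multi_indices :: "('d::finite \<Rightarrow> nat) \<Rightarrow> ('d \<Rightarrow> nat) set" where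
  "multi_indices N = {k. \<forall>i. k i < N i}"

definition grid :: "('d::finite \<Rightarrow> nat) \<Rightarrow> ('d \<Rightarrow> nat) \<Rightarrow> (real^'d) set" where
  "grid q N = {(\<chi> i. real (k i) / (real (q i) * real (N i))) | k. \<forall>i. k i < N i * q i}"

text \<open>
  The functions live on the unit cube, which is the box from 0 to the all-ones vector, so the
  (closed) support is taken inside it.
\<close>

definition supp :: "(real^'d::finite \<Rightarrow> complex) \<Rightarrow> (real^'d) set" where
  "supp f = closure {t \<in> cbox 0 1. f t \<noteq> 0}"

definition boundary_indices ::
    "('d::finite \<Rightarrow> nat) \<Rightarrow> (real^'d) set \<Rightarrow> ('d \<Rightarrow> nat) \<Rightarrow> ('d \<Rightarrow> nat) set" where
  "boundary_indices p \<Omega> N = {l \<in> multi_indices N.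
     supp (Phi p N l) \<inter> \<Omega> \<noteq> {} \<and> supp (Phi p N l) \<inter> (cbox 0 1 - \<Omega>) \<noteq> {}}"

definition discrete_supp ::
    "('d::finite \<Rightarrow> nat) \<Rightarrow> ('d \<Rightarrow> nat) \<Rightarrow> (real^'d \<Rightarrow> complex) \<Rightarrow> (real^'d) set" where
  "discrete_supp q N f = supp f \<inter> grid q N"

definition discrete_boundary_indices ::
    "('d::finite \<Rightarrow> nat) \<Rightarrow> ('d \<Rightarrow> nat) \<Rightarrow> (real^'d) set \<Rightarrow> ('d \<Rightarrow> nat) \<Rightarrow> ('d \<Rightarrow> nat) set" where
  "discrete_boundary_indices p q \<Omega> N = {l \<in> multi_indices N.
     discrete_supp q N (Phi_discrete p N l) \<inter> \<Omega> \<noteq> {} \<and>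
     discrete_supp q N (Phi_discrete p N l) \<inter> (cbox 0 1 - \<Omega>) \<noteq> {}}"

text \<open>
  Matrices indexed by finite sets become library matrices through an enumeration of each index
  set; all statements are made for every enumeration.
\<close>

definition enumerates :: "'a list \<Rightarrow> 'a set \<Rightarrow> bool" where
  "enumerates xs S \<longleftrightarrow> distinct xs \<and> set xs = S"

definition indexed_mat :: "'a list \<Rightarrow> 'b list \<Rightarrow> ('a \<Rightarrow> 'b \<Rightarrow> complex) \<Rightarrow> complex mat" where
  "indexed_mat xs ys f = Matrix.mat (length xs) (length ys) (\<lambda>(i, j). f (xs ! i) (ys ! j))"

definition A_cont ::
    "('d::finite \<Rightarrow> nat) \<Rightarrow> (real^'d) set \<Rightarrow> ('d \<Rightarrow> nat) \<Rightarrow> ('d \<Rightarrow> nat) list \<Rightarrow> complex mat" where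
  "A_cont p \<Omega> N ks = indexed_mat ks ks (\<lambda>k l. L2_inner \<Omega> (Phi p N k) (Phi p N l))"

definition Z_cont ::
    "('d::finite \<Rightarrow> nat) \<Rightarrow> ('d \<Rightarrow> nat) \<Rightarrow> ('d \<Rightarrow> nat) list \<Rightarrow> complex mat" where
  "Z_cont p N ks = indexed_mat ks ks (\<lambda>k l. L2_inner (cbox 0 1) (Phi_dual p N k) (Phi_dual p N l))"

definition A_disc ::
    "('d::finite \<Rightarrow> nat) \<Rightarrow> ('d \<Rightarrow> nat) \<Rightarrow> (real^'d) list \<Rightarrow> ('d \<Rightarrow> nat) list \<Rightarrow> complex mat" where
  "A_disc p N ts ks = indexed_mat ts ks (\<lambda>t l. Phi_discrete p N l t)"

definition Z_disc ::
    "('d::finite \<Rightarrow> nat) \<Rightarrow> ('d \<Rightarrow> nat) \<Rightarrow> ('d \<Rightarrow> nat) \<Rightarrow> (real^'d) list \<Rightarrow> ('d \<Rightarrow> nat) list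
       \<Rightarrow> complex mat" where
  "Z_disc p q N ts ks = indexed_mat ts ks (\<lambda>t l. Phi_discrete_dual p q N l t)"

definition AZ_residual :: "complex mat \<Rightarrow> complex mat \<Rightarrow> complex mat" where
  "AZ_residual A Z = A - A * mat_adjoint Z * A"

definition mat_rank :: "complex mat \<Rightarrow> nat" where
  "mat_rank B = vec_space.rank (dim_row B) B"

definition nonzero_cols :: "complex mat \<Rightarrow> nat set" where
  "nonzero_cols B = {j. j < dim_col B \<and> col B j \<noteq> 0\<^sub>v (dim_row B)}"

definition large_rows :: "real \<Rightarrow> complex mat \<Rightarrow> nat set" where
  "large_rows \<delta> B = {i. i < dim_row B \<and> (\<exists>j<dim_col B. cmod (B $$ (i, j)) > \<delta>)}"

definition large_entries :: "real \<Rightarrow> complex mat \<Rightarrow> (nat \<times> nat) set" where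
  "large_entries \<delta> B = {(i, j). i < dim_row B \<and> j < dim_col B \<and> cmod (B $$ (i, j)) > \<delta>}"

end

theory Submission
  imports Defs
begin

text \<open>
  Write \<open>u\<close> for the basis function \<open>\<phi> j\<close> cut off to \<open>\<Omega>\<close>, and \<open>P\<close> for the orthogonal projection onto the
  spline space, \<open>P u = \<Sum>k. (u, \<psi> k) \<phi> k\<close> with \<open>\<psi>\<close> the dual basis.  Column \<open>j\<close> of \<open>A - A Z\<^sup>* A\<close> is obtained from
  the function \<open>h = (u - P u)\<close> cut off to \<open>\<Omega>\<close>: by sampling it on the grid in the discrete case, by taking its
  inner products with the basis in the continuous case.  If the support of \<open>\<phi> j\<close> misses \<open>\<Omega>\<close> or its complement
  then \<open>u\<close> is \<open>0\<close> or \<open>\<phi> j\<close>, so \<open>h = 0\<close>; this gives the bounds on the non-zero columns and on the rank.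
  In general \<open>\<parallel>h\<parallel> \<le> \<parallel>u\<parallel> \<le> \<parallel>\<phi> j\<parallel>\<close>, and the partition of unity property of B-splines bounds \<open>\<parallel>\<phi> j\<parallel>\<close> and,
  in the continuous case, yields a Bessel inequality with constant 1.  Every column therefore has an
  \<open>\<ell>\<^sup>2\<close> norm bounded independently of \<open>N\<close>, hence boundedly many entries above \<open>\<delta>\<close>; no decay of the
  dual basis is needed.
\<close>

section \<open>Matrices indexed by finite sets\<close>

text \<open>The two settings differ in what is known of the duals. In the discrete case their unique
  existence is a hypothesis. In the continuous case \<open>phi_dual\<close> is a definite
  description, so nothing can be said of it until the Gram matrix of the periodic B-splines on the
  unit interval is shown to be invertible, for every degree and every \<open>n\<close>, also when
  \<open>n\<close> is smaller than the width \<open>p + 1\<close> of the B-spline and a function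
  overlaps its own periods. For this, combinations of the basis are rescaled to spline series with
  integer spacing and \<open>n\<close>-periodic coefficients, and a bounded coefficient sequence
  whose series vanishes is shown to be zero. The Bessel inequality enters only in the continuous
  case, where the entries are inner products of h with the basis; there the sup bound and the L1
  norm of a basis function are reciprocal, and the final constant is
  \<open>1 / \<delta>\<^sup>2\<close>. In the discrete case the entries are values of h itself; the
  values of a basis function lie between 0 and 1 in modulus and their moduli sum over the grid to
  the product of the \<open>q i\<close>, which replaces the numerator 1.\<close>

lemma sum_enumerates:
  assumes "enumerates xs S"
  shows "(\<Sum>i<length xs. f (xs ! i)) = sum f S"
proof -
  have "sum f S = sum_list (map f xs)"
    using assms by (simp add: enumerates_def sum_list_distinct_conv_sum_set)
  also have "\<dots> = (\<Sum>i<length xs. f (xs ! i))"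
    by (simp add: sum_list_sum_nth atLeast0LessThan)
  finally show ?thesis by simp
qed

lemma mat_adjoint_index:
  assumes "i < dim_col A" "j < dim_row A"
  shows "mat_adjoint A $$ (i, j) = conjugate (A $$ (j, i))"
  using assms by (simp add: mat_adjoint_def mat_of_rows_index)

text \<open>The adjoint of \<open>Z\<close> is made to meet \<open>A\<close> first: the inner sum is
  then, up to conjugation, a coefficient of the projection of one cut-off basis function, and it is
  recognised as such in both settings.\<close>

lemma AZ_residual_indexed_mat:
  assumes xs: "enumerates xs S" and ys: "enumerates ys T"
  shows "AZ_residual (indexed_mat xs ys a) (indexed_mat xs ys z) =
    indexed_mat xs ys (\<lambda>x y. a x y - (\<Sum>k\<in>T. a x k * (\<Sum>m\<in>S. cnj (z m k) * a m y)))"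
    (is "AZ_residual ?A ?Z = ?R")
proof -
  have dims: "?A \<in> carrier_mat (length xs) (length ys)" "?Z \<in> carrier_mat (length xs) (length ys)"
    by (auto simp: indexed_mat_def)
  then have adj: "mat_adjoint ?Z \<in> carrier_mat (length ys) (length xs)"
    by (auto simp: mat_adjoint_def)
  have assoc: "?A * mat_adjoint ?Z * ?A = ?A * (mat_adjoint ?Z * ?A)"
    using dims adj by (intro assoc_mult_mat) auto
  show ?thesis
  proof (rule eq_matI)
    fix i j assume "i < dim_row ?R" "j < dim_col ?R"
    then have i: "i < length xs" and j: "j < length ys"
      by (auto simp: indexed_mat_def)
    have ZA: "(mat_adjoint ?Z * ?A) $$ (k, j) = (\<Sum>m\<in>S. cnj (z m (ys ! k)) * a m (ys ! j))"
      if k: "k < length ys" for k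
    proof -
      have "(mat_adjoint ?Z * ?A) $$ (k, j)
          = (\<Sum>m<length xs. mat_adjoint ?Z $$ (k, m) * ?A $$ (m, j))"
        using dims adj k j by (auto simp: scalar_prod_def atLeast0LessThan)
      also have "\<dots> = (\<Sum>m<length xs. cnj (z (xs ! m) (ys ! k)) * a (xs ! m) (ys ! j))"
        using k j by (intro sum.cong refl) (simp add: mat_adjoint_index indexed_mat_def)
      finally show ?thesis
        using sum_enumerates[OF xs, of "\<lambda>m. cnj (z m (ys ! k)) * a m (ys ! j)"] by simp
    qed
    have "(?A * (mat_adjoint ?Z * ?A)) $$ (i, j)
        = (\<Sum>k<length ys. ?A $$ (i, k) * (mat_adjoint ?Z * ?A) $$ (k, j))"
      using dims adj i j by (auto simp: scalar_prod_def atLeast0LessThan)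
    also have "\<dots> = (\<Sum>k<length ys. a (xs ! i) (ys ! k) *
        (\<Sum>m\<in>S. cnj (z m (ys ! k)) * a m (ys ! j)))"
      using i j by (intro sum.cong refl) (simp add: ZA, simp add: indexed_mat_def)
    also have "\<dots> = (\<Sum>k\<in>T. a (xs ! i) k * (\<Sum>m\<in>S. cnj (z m k) * a m (ys ! j)))"
      by (rule sum_enumerates[OF ys])
    finally have eq: "(?A * (mat_adjoint ?Z * ?A)) $$ (i, j)
      = (\<Sum>k\<in>T. a (xs ! i) k * (\<Sum>m\<in>S. cnj (z m k) * a m (ys ! j)))" .
    have "AZ_residual ?A ?Z $$ (i, j) = ?A $$ (i, j) - (?A * (mat_adjoint ?Z * ?A)) $$ (i, j)"
      unfolding AZ_residual_def assoc using dims adj i j by auto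
    then show "AZ_residual ?A ?Z $$ (i, j) = ?R $$ (i, j)"
      unfolding eq using i j by (simp add: indexed_mat_def)
  qed (use dims adj in \<open>auto simp: AZ_residual_def indexed_mat_def\<close>)
qed

text \<open>The rank is the size of a maximal independent set of columns. Such a set omits the zero
  vector, so it lies in the image of the non-zero column indices; repeated columns only shrink that
  image.\<close>

lemma mat_rank_le_card_nonzero_cols: "mat_rank B \<le> card (nonzero_cols B)"
proof -
  interpret vec_space "TYPE(complex)" "dim_row B" .
  have B: "B \<in> carrier_mat (dim_row B) (dim_col B)" by auto
  obtain S where S: "maximal S (\<lambda>T. T \<subseteq> set (cols B) \<and> lin_indpt T)"
    using maximal_exists[of "\<lambda>T. T \<subseteq> set (cols B) \<and> lin_indpt T" "card (set (cols B))" "{}"]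
    by (meson List.finite_set card_mono empty_iff empty_subsetI finite_lin_indpt2 rev_finite_subset)
  have sub: "S \<subseteq> set (cols B)" and li: "lin_indpt S"
    using S by (auto simp: maximal_def)
  have "S \<subseteq> carrier_vec (dim_row B)" using sub cols_dim[of B] by (rule subset_trans)
  then have "0\<^sub>v (dim_row B) \<notin> S"
    using li zero_nin_lin_indpt[of S] by auto
  then have "S \<subseteq> col B ` nonzero_cols B"
    using sub by (auto simp: nonzero_cols_def cols_def image_iff) force+
  moreover have fin: "finite (nonzero_cols B)" by (simp add: nonzero_cols_def)
  ultimately have "card S \<le> card (nonzero_cols B)"
    by (meson card_image_le card_mono finite_imageI le_trans)
  then show ?thesis
    unfolding mat_rank_def rank_card_indpt[OF B S] .
qed

lemma card_nonzero_cols_indexed_mat: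
  assumes ys: "enumerates ys T" and K: "finite K"
    and zero: "\<And>x y. x \<in> set xs \<Longrightarrow> y \<in> T - K \<Longrightarrow> r x y = 0"
  shows "card (nonzero_cols (indexed_mat xs ys r)) \<le> card K"
proof (rule card_inj_on_le[where f = "\<lambda>j. ys ! j"])
  show "inj_on ((!) ys) (nonzero_cols (indexed_mat xs ys r))"
    using ys by (auto simp: inj_on_def nonzero_cols_def indexed_mat_def enumerates_def
        nth_eq_iff_index_eq)
  show "(!) ys ` nonzero_cols (indexed_mat xs ys r) \<subseteq> K"
  proof (clarsimp simp: nonzero_cols_def)
    fix j assume j: "j < dim_col (indexed_mat xs ys r)"
      and nz: "col (indexed_mat xs ys r) j \<noteq> 0\<^sub>v (dim_row (indexed_mat xs ys r))"
    show "ys ! j \<in> K"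
    proof (rule ccontr)
      assume "ys ! j \<notin> K"
      then have "col (indexed_mat xs ys r) j = 0\<^sub>v (dim_row (indexed_mat xs ys r))"
        using j ys zero by (intro eq_vecI) (auto simp: indexed_mat_def enumerates_def)
      with nz show False by simp
    qed
  qed
qed (fact K)

text \<open>Chebyshev's inequality in each column: an entry above \<open>\<delta>\<close>
  contributes at least \<open>\<delta>\<^sup>2\<close> to the column sum, so a column has at most
  \<open>C / \<delta>\<^sup>2\<close> of them. A column containing one is non-zero, which confines
  the count to \<open>nonzero_cols B\<close>.\<close>

lemma card_large_entries_le:
  assumes "\<delta> > 0"
    and bound: "\<And>j. j < dim_col B \<Longrightarrow> (\<Sum>i<dim_row B. (cmod (B $$ (i, j)))\<^sup>2) \<le> C"
  shows "real (card (large_entries \<delta> B)) \<le> C / \<delta>\<^sup>2 * real (card (nonzero_cols B))"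
proof -
  define L where "L j = {i. i < dim_row B \<and> cmod (B $$ (i, j)) > \<delta>}" for j
  have fin: "finite (nonzero_cols B)" "finite (L j)" for j
    by (simp_all add: nonzero_cols_def L_def)
  have "large_entries \<delta> B \<subseteq> (\<lambda>(j, i). (i, j)) ` (SIGMA j:nonzero_cols B. L j)"
  proof
    fix x assume "x \<in> large_entries \<delta> B"
    then obtain i j where x: "x = (i, j)" "i < dim_row B" "j < dim_col B" "cmod (B $$ (i, j)) > \<delta>"
      by (auto simp: large_entries_def)
    have "col B j \<noteq> 0\<^sub>v (dim_row B)"
    proof
      assume "col B j = 0\<^sub>v (dim_row B)"
      then have "vec_index (col B j) i = 0" using x by simp
      then show False using x \<open>\<delta> > 0\<close> by simp
    qed
    then show "x \<in> (\<lambda>(j, i). (i, j)) ` (SIGMA j:nonzero_cols B. L j)"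
      using x by (auto simp: nonzero_cols_def L_def image_iff)
  qed
  then have "card (large_entries \<delta> B) \<le> card (SIGMA j:nonzero_cols B. L j)"
    using fin by (meson card_image_le card_mono finite_SigmaI finite_imageI le_trans)
  also have "\<dots> = (\<Sum>j\<in>nonzero_cols B. card (L j))"
    using fin by simp
  finally have "real (card (large_entries \<delta> B)) \<le> (\<Sum>j\<in>nonzero_cols B. real (card (L j)))"
    by (metis of_nat_le_iff of_nat_sum)
  also have "\<dots> \<le> (\<Sum>j\<in>nonzero_cols B. C / \<delta>\<^sup>2)"
  proof (rule sum_mono)
    fix j assume "j \<in> nonzero_cols B"
    then have j: "j < dim_col B" by (simp add: nonzero_cols_def)
    have "real (card (L j)) * \<delta>\<^sup>2 = (\<Sum>i\<in>L j. \<delta>\<^sup>2)" by simp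
    also have "\<dots> \<le> (\<Sum>i\<in>L j. (cmod (B $$ (i, j)))\<^sup>2)"
      using \<open>\<delta> > 0\<close> by (intro sum_mono power_mono) (auto simp: L_def)
    also have "\<dots> \<le> (\<Sum>i<dim_row B. (cmod (B $$ (i, j)))\<^sup>2)"
      by (intro sum_mono2) (auto simp: L_def)
    also have "\<dots> \<le> C" by (rule bound[OF j])
    finally show "real (card (L j)) \<le> C / \<delta>\<^sup>2"
      using \<open>\<delta> > 0\<close> by (simp add: field_simps)
  qed
  finally show ?thesis by (simp add: mult.commute)
qed

lemma card_large_rows_le: "card (large_rows \<delta> B) \<le> card (large_entries \<delta> B)"
proof -
  have "large_entries \<delta> B \<subseteq> {..<dim_row B} \<times> {..<dim_col B}"
    by (auto simp: large_entries_def)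
  then have "finite (large_entries \<delta> B)"
    by (rule finite_subset) simp
  moreover have "large_rows \<delta> B \<subseteq> fst ` large_entries \<delta> B"
    by (force simp: large_rows_def large_entries_def)
  ultimately show ?thesis
    by (meson card_image_le card_mono finite_imageI le_trans)
qed

text \<open>All four claims, in both settings, reduce to two facts about the entries: they vanish in
  the columns outside \<open>K\<close>, and every column has squared norm at most
  \<open>C\<close>.\<close>

lemma indexed_mat_bounds:
  assumes xs: "enumerates xs S" and ys: "enumerates ys T" and K: "finite K" and "\<delta> > 0" and "C \<ge> 0"
    and zero: "\<And>x y. x \<in> S \<Longrightarrow> y \<in> T - K \<Longrightarrow> r x y = 0"
    and bound: "\<And>y. y \<in> T \<Longrightarrow> (\<Sum>x\<in>S. (cmod (r x y))\<^sup>2) \<le> C"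
  defines "R \<equiv> indexed_mat xs ys r"
  shows "card (nonzero_cols R) \<le> card K" "mat_rank R \<le> card K"
    "real (card (large_rows \<delta> R)) \<le> C / \<delta>\<^sup>2 * real (card K)"
    "real (card (large_entries \<delta> R)) \<le> C / \<delta>\<^sup>2 * real (card K)"
proof -
  show nz: "card (nonzero_cols R) \<le> card K"
    unfolding R_def using xs by (intro card_nonzero_cols_indexed_mat[OF ys K] zero)
      (auto simp: enumerates_def)
  then show "mat_rank R \<le> card K"
    using mat_rank_le_card_nonzero_cols[of R] by simp
  have "real (card (large_entries \<delta> R)) \<le> C / \<delta>\<^sup>2 * real (card (nonzero_cols R))"
  proof (rule card_large_entries_le[OF \<open>\<delta> > 0\<close>])
    fix j assume "j < dim_col R"
    then have j: "j < length ys" by (simp add: R_def indexed_mat_def)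
    have "(\<Sum>i<dim_row R. (cmod (R $$ (i, j)))\<^sup>2) = (\<Sum>i<length xs. (cmod (r (xs ! i) (ys ! j)))\<^sup>2)"
      using j by (simp add: R_def indexed_mat_def)
    also have "\<dots> = (\<Sum>x\<in>S. (cmod (r x (ys ! j)))\<^sup>2)"
      by (rule sum_enumerates[OF xs])
    also have "\<dots> \<le> C"
      using j ys by (intro bound) (auto simp: enumerates_def)
    finally show "(\<Sum>i<dim_row R. (cmod (R $$ (i, j)))\<^sup>2) \<le> C" .
  qed
  also have "\<dots> \<le> C / \<delta>\<^sup>2 * real (card K)"
    using nz \<open>C \<ge> 0\<close> by (intro mult_left_mono) auto
  finally show "real (card (large_entries \<delta> R)) \<le> C / \<delta>\<^sup>2 * real (card K)" .
  then show "real (card (large_rows \<delta> R)) \<le> C / \<delta>\<^sup>2 * real (card K)"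
    using card_large_rows_le[of \<delta> R] by linarith
qed

section \<open>Biorthogonal systems and their projections\<close>

text \<open>Over a finite measure these functions are integrable and closed under products, so every
  inner product below exists. They are functions rather than classes modulo null sets, because the
  discrete residual is read off pointwise.\<close>

definition bounded_measurable :: "'a measure \<Rightarrow> ('a \<Rightarrow> complex) set" where
  "bounded_measurable M = {f \<in> borel_measurable M. \<exists>B. \<forall>x\<in>space M. cmod (f x) \<le> B}"

text \<open>Lebesgue measure restricted to the interval or the cube yields \<open>L2_inner\<close>,
  counting measure on the grid yields the discrete inner product, so one theory of projections
  serves both settings.\<close>

definition ip :: "'a measure \<Rightarrow> ('a \<Rightarrow> complex) \<Rightarrow> ('a \<Rightarrow> complex) \<Rightarrow> complex" where
  "ip M f g = (LINT x|M. f x * cnj (g x))"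

lemma bounded_measurableI:
  "f \<in> borel_measurable M \<Longrightarrow> (\<And>x. x \<in> space M \<Longrightarrow> cmod (f x) \<le> B) \<Longrightarrow> f \<in> bounded_measurable M"
  by (auto simp: bounded_measurable_def)

lemma bounded_measurable_mult:
  assumes "f \<in> bounded_measurable M" "g \<in> bounded_measurable M"
  shows "(\<lambda>x. f x * g x) \<in> bounded_measurable M"
proof -
  obtain B C where BC: "\<forall>x\<in>space M. cmod (f x) \<le> B" "\<forall>x\<in>space M. cmod (g x) \<le> C"
    using assms by (auto simp: bounded_measurable_def)
  show ?thesis
  proof (rule bounded_measurableI[where B = "B * C"])
    show "(\<lambda>x. f x * g x) \<in> borel_measurable M"
      using assms by (auto simp: bounded_measurable_def)
    fix x assume "x \<in> space M"
    then show "cmod (f x * g x) \<le> B * C"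
      unfolding norm_mult using BC by (intro mult_mono) (auto intro: order_trans[OF norm_ge_zero])
  qed
qed

lemma bounded_measurable_diff:
  assumes "f \<in> bounded_measurable M" "g \<in> bounded_measurable M"
  shows "(\<lambda>x. f x - g x) \<in> bounded_measurable M"
proof -
  obtain B C where BC: "\<forall>x\<in>space M. cmod (f x) \<le> B" "\<forall>x\<in>space M. cmod (g x) \<le> C"
    using assms by (auto simp: bounded_measurable_def)
  show ?thesis
  proof (rule bounded_measurableI[where B = "B + C"])
    show "(\<lambda>x. f x - g x) \<in> borel_measurable M"
      using assms by (auto simp: bounded_measurable_def)
    fix x assume "x \<in> space M"
    then show "cmod (f x - g x) \<le> B + C"
      using BC norm_triangle_ineq4[of "f x" "g x"] by fastforce
  qed
qed

lemma bounded_measurable_const: "(\<lambda>x. c) \<in> bounded_measurable M"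
  by (rule bounded_measurableI[where B = "cmod c"]) auto

lemma bounded_measurable_indicator: "A \<in> sets M \<Longrightarrow> indicator A \<in> bounded_measurable M"
  by (rule bounded_measurableI[where B = 1]) (auto simp: indicator_def)

lemma bounded_measurable_cnj: "f \<in> bounded_measurable M \<Longrightarrow> (\<lambda>x. cnj (f x)) \<in> bounded_measurable M"
  by (auto simp: bounded_measurable_def intro: borel_measurable_continuous_on continuous_on_cnj)

lemma bounded_measurable_sum:
  assumes "\<And>k. k \<in> I \<Longrightarrow> f k \<in> bounded_measurable M"
  shows "(\<lambda>x. \<Sum>k\<in>I. f k x) \<in> bounded_measurable M"
proof -
  obtain B where B: "\<forall>k\<in>I. \<forall>x\<in>space M. cmod (f k x) \<le> B k"
    using assms unfolding bounded_measurable_def by simp metis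
  show ?thesis
  proof (rule bounded_measurableI[where B = "sum B I"])
    show "(\<lambda>x. \<Sum>k\<in>I. f k x) \<in> borel_measurable M"
      using assms by (intro borel_measurable_sum) (auto simp: bounded_measurable_def)
    fix x assume "x \<in> space M"
    then show "cmod (\<Sum>k\<in>I. f k x) \<le> sum B I"
      using B by (intro sum_norm_le) auto
  qed
qed

lemmas bounded_measurable_intros =
  bounded_measurable_mult bounded_measurable_diff bounded_measurable_const
  bounded_measurable_indicator bounded_measurable_cnj bounded_measurable_sum

section \<open>Sesquilinearity and a Bessel inequality over a finite measure\<close>

context finite_measure
begin

lemma integrable_bounded_measurable:
  assumes "f \<in> bounded_measurable M"
  shows "integrable M f"
proof -
  obtain B where "\<forall>x\<in>space M. cmod (f x) \<le> B"
    using assms by (auto simp: bounded_measurable_def)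
  then show ?thesis
    using assms by (intro integrable_const_bound[where B = B]) (auto simp: bounded_measurable_def)
qed

lemma integrable_ip:
  assumes "f \<in> bounded_measurable M" "g \<in> bounded_measurable M"
  shows "integrable M (\<lambda>x. f x * cnj (g x))"
  using assms by (intro integrable_bounded_measurable bounded_measurable_intros)

lemma integrable_norm_square:
  "f \<in> bounded_measurable M \<Longrightarrow> integrable M (\<lambda>x. (cmod (f x))\<^sup>2)"
  using integrable_norm[OF integrable_ip[of f f]] by (simp add: norm_mult power2_eq_square)

lemma cnj_ip: "cnj (ip M f g) = ip M g f"
  unfolding ip_def by (subst Bochner_Integration.integral_cnj[symmetric]) (simp add: mult.commute)

lemma ip_sum_left:
  assumes "\<And>k. k \<in> I \<Longrightarrow> f k \<in> bounded_measurable M" "g \<in> bounded_measurable M"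
  shows "ip M (\<lambda>x. \<Sum>k\<in>I. a k * f k x) g = (\<Sum>k\<in>I. a k * ip M (f k) g)"
proof -
  have "ip M (\<lambda>x. \<Sum>k\<in>I. a k * f k x) g = (LINT x|M. (\<Sum>k\<in>I. a k * (f k x * cnj (g x))))"
    unfolding ip_def by (simp add: sum_distrib_right mult.assoc)
  also have "\<dots> = (\<Sum>k\<in>I. (LINT x|M. a k * (f k x * cnj (g x))))"
    using assms by (intro Bochner_Integration.integral_sum integrable_mult_right integrable_ip) auto
  finally show ?thesis by (simp add: ip_def)
qed

lemma ip_sum_right:
  assumes "\<And>k. k \<in> I \<Longrightarrow> f k \<in> bounded_measurable M" "g \<in> bounded_measurable M"
  shows "ip M g (\<lambda>x. \<Sum>k\<in>I. a k * f k x) = (\<Sum>k\<in>I. cnj (a k) * ip M g (f k))"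
proof -
  have "ip M g (\<lambda>x. \<Sum>k\<in>I. a k * f k x) = cnj (ip M (\<lambda>x. \<Sum>k\<in>I. a k * f k x) g)"
    by (simp add: cnj_ip)
  also have "\<dots> = (\<Sum>k\<in>I. cnj (a k) * cnj (ip M (f k) g))"
    using assms by (subst ip_sum_left) auto
  finally show ?thesis by (simp add: cnj_ip)
qed

lemma ip_diff_left:
  assumes "f \<in> bounded_measurable M" "g \<in> bounded_measurable M" "h \<in> bounded_measurable M"
  shows "ip M (\<lambda>x. f x - g x) h = ip M f h - ip M g h"
  using Bochner_Integration.integral_diff[OF integrable_ip[OF assms(1,3)] integrable_ip[OF assms(2,3)]]
  by (simp add: ip_def left_diff_distrib)

lemma ip_diff_right:
  assumes "f \<in> bounded_measurable M" "g \<in> bounded_measurable M" "h \<in> bounded_measurable M"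
  shows "ip M h (\<lambda>x. f x - g x) = ip M h f - ip M h g"
  using Bochner_Integration.integral_diff[OF integrable_ip[OF assms(3,1)] integrable_ip[OF assms(3,2)]]
  by (simp add: ip_def right_diff_distrib)

lemma ip_self: "ip M f f = complex_of_real (LINT x|M. (cmod (f x))\<^sup>2)"
  unfolding ip_def by (simp add: complex_norm_square[symmetric] flip: of_real_power)

text \<open>
  The bounds \<open>w\<close> and \<open>1 / w\<close> cancel in the Cauchy-Schwarz estimate with weight \<open>\<bar>\<phi> k\<bar>\<close>,
  so the Bessel constant is 1.
\<close>

lemma bessel_partition:
  assumes I: "finite I" and \<phi>: "\<And>k. k \<in> I \<Longrightarrow> \<phi> k \<in> bounded_measurable M"
    and h: "h \<in> bounded_measurable M" and w: "w > 0"
    and sum: "\<And>x. x \<in> space M \<Longrightarrow> (\<Sum>k\<in>I. cmod (\<phi> k x)) \<le> w"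
    and int: "\<And>k. k \<in> I \<Longrightarrow> (LINT x|M. cmod (\<phi> k x)) \<le> 1 / w"
  shows "(\<Sum>k\<in>I. (cmod (ip M (\<phi> k) h))\<^sup>2) \<le> (LINT x|M. (cmod (h x))\<^sup>2)"
proof -
  note intg = integrable_norm_square[OF h]
  have *: "integrable M (\<lambda>x. cmod (\<phi> k x) * (cmod (h x))\<^sup>2)"
       "integrable M (\<lambda>x. cmod (\<phi> k x) * cmod (h x))"
       "integrable M (\<lambda>x. cmod (\<phi> k x))" if k: "k \<in> I" for k
  proof -
    have "integrable M (\<lambda>x. cmod (\<phi> k x * (h x * h x)))" "integrable M (\<lambda>x. cmod (\<phi> k x * h x))"
         "integrable M (\<lambda>x. cmod (\<phi> k x))"
      by (intro integrable_norm integrable_bounded_measurable bounded_measurable_intros h \<phi>[OF k];fail)+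
    then show "integrable M (\<lambda>x. cmod (\<phi> k x) * (cmod (h x))\<^sup>2)"
       "integrable M (\<lambda>x. cmod (\<phi> k x) * cmod (h x))"
       "integrable M (\<lambda>x. cmod (\<phi> k x))"
      by (simp_all add: norm_mult power2_eq_square)
  qed
  have cs: "w * (cmod (ip M (\<phi> k) h))\<^sup>2 \<le> (LINT x|M. cmod (\<phi> k x) * (cmod (h x))\<^sup>2)" if k: "k \<in> I" for k
  proof -
    define b where "b = (LINT x|M. cmod (\<phi> k x) * cmod (h x))"
    \<comment> \<open>This value minimises the quadratic \<open>r\<^sup>2 / w - 2 * r * b\<close>
      that bounds the expanded weighted square below; its minimum \<open>- w * b\<^sup>2\<close>
      gives the estimate.\<close>
    define r where "r = w * b"
    have ip_le: "cmod (ip M (\<phi> k) h) \<le> b"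
      unfolding ip_def b_def using integral_norm_bound[of M "\<lambda>x. \<phi> k x * cnj (h x)"]
      by (simp add: norm_mult)
    have "0 \<le> (LINT x|M. cmod (\<phi> k x) * (cmod (h x) - r)\<^sup>2)"
      by (intro integral_nonneg_AE) auto
    also have "\<dots> = (LINT x|M. cmod (\<phi> k x) * (cmod (h x))\<^sup>2 - 2 * r * (cmod (\<phi> k x) * cmod (h x))
        + r\<^sup>2 * cmod (\<phi> k x))"
      by (simp add: power2_eq_square algebra_simps)
    also have "\<dots> = (LINT x|M. cmod (\<phi> k x) * (cmod (h x))\<^sup>2) - 2 * r * b
        + r\<^sup>2 * (LINT x|M. cmod (\<phi> k x))"
      using *[OF k] by (simp add: b_def)
    also have "\<dots> \<le> (LINT x|M. cmod (\<phi> k x) * (cmod (h x))\<^sup>2) - 2 * r * b + r\<^sup>2 * (1 / w)"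
      using int[OF k] by (intro add_left_mono mult_left_mono) auto
    also have "r\<^sup>2 * (1 / w) = r * b"
      using w by (simp add: r_def power2_eq_square)
    finally have "w * b\<^sup>2 \<le> (LINT x|M. cmod (\<phi> k x) * (cmod (h x))\<^sup>2)"
      by (simp add: r_def power2_eq_square algebra_simps)
    moreover have "w * (cmod (ip M (\<phi> k) h))\<^sup>2 \<le> w * b\<^sup>2"
      using w ip_le by (intro mult_left_mono power_mono) auto
    ultimately show ?thesis by simp
  qed
  have "w * (\<Sum>k\<in>I. (cmod (ip M (\<phi> k) h))\<^sup>2) \<le> (\<Sum>k\<in>I. (LINT x|M. cmod (\<phi> k x) * (cmod (h x))\<^sup>2))"
    unfolding sum_distrib_left by (intro sum_mono cs)
  also have "\<dots> = (LINT x|M. (\<Sum>k\<in>I. cmod (\<phi> k x) * (cmod (h x))\<^sup>2))"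
    using * by (intro Bochner_Integration.integral_sum[symmetric]) auto
  also have "\<dots> \<le> (LINT x|M. w * (cmod (h x))\<^sup>2)"
  proof (rule integral_mono)
    show "integrable M (\<lambda>x. \<Sum>k\<in>I. cmod (\<phi> k x) * (cmod (h x))\<^sup>2)"
      using * by (intro Bochner_Integration.integrable_sum) auto
    show "integrable M (\<lambda>x. w * (cmod (h x))\<^sup>2)" using intg by simp
    show "(\<Sum>k\<in>I. cmod (\<phi> k x) * (cmod (h x))\<^sup>2) \<le> w * (cmod (h x))\<^sup>2" if "x \<in> space M" for x
      unfolding sum_distrib_right[symmetric] using sum[OF that] by (intro mult_right_mono) auto
  qed
  finally show ?thesis using w by simp
qed

end

text \<open>Biorthogonality together with \<psi> lying in the span of \<phi> is enough to make the
  expansion operator an orthogonal projection; the symmetry of \<open>c\<close> that this requires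
  is derived below.\<close>

locale biorthogonal_system = finite_measure M for M :: "'a measure" +
  fixes I :: "'i set" and \<phi> \<psi> :: "'i \<Rightarrow> 'a \<Rightarrow> complex" and c :: "'i \<Rightarrow> 'i \<Rightarrow> complex"
  assumes finite_index: "finite I"
    and basis_bounded: "k \<in> I \<Longrightarrow> \<phi> k \<in> bounded_measurable M"
    and dual_expansion: "k \<in> I \<Longrightarrow> \<psi> k = (\<lambda>x. \<Sum>l\<in>I. c k l * \<phi> l x)"
    and biorthogonal: "k \<in> I \<Longrightarrow> l \<in> I \<Longrightarrow> ip M (\<phi> k) (\<psi> l) = (if k = l then 1 else 0)"
begin

definition proj :: "('a \<Rightarrow> complex) \<Rightarrow> 'a \<Rightarrow> complex" where
  "proj u x = (\<Sum>k\<in>I. ip M u (\<psi> k) * \<phi> k x)"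

lemma dual_bounded: "k \<in> I \<Longrightarrow> \<psi> k \<in> bounded_measurable M"
  unfolding dual_expansion by (intro bounded_measurable_intros basis_bounded)

text \<open>Pairing the expansion of \<open>\<psi> k\<close> with \<open>\<psi> l\<close> leaves a
  single term. Hence \<open>c\<close> is the Gram matrix of the dual basis: it is Hermitian, and in
  the continuous case it is the matrix \<open>Z\<close> itself.\<close>

lemma dual_coefficient:
  assumes "k \<in> I" "l \<in> I"
  shows "c k l = ip M (\<psi> k) (\<psi> l)"
proof -
  have "ip M (\<psi> k) (\<psi> l) = (\<Sum>j\<in>I. c k j * ip M (\<phi> j) (\<psi> l))"
    unfolding dual_expansion[OF assms(1)]
    by (intro ip_sum_left basis_bounded dual_bounded assms)
  also have "\<dots> = (\<Sum>j\<in>I. if j = l then c k j else 0)"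
    using assms by (intro sum.cong refl) (simp add: biorthogonal)
  finally show ?thesis using assms finite_index by simp
qed

lemma dual_coefficient_hermitian: "k \<in> I \<Longrightarrow> l \<in> I \<Longrightarrow> cnj (c k l) = c l k"
  by (simp add: dual_coefficient cnj_ip)

lemma proj_bounded: "proj u \<in> bounded_measurable M"
  unfolding proj_def[abs_def] by (intro bounded_measurable_intros basis_bounded)

lemma ip_proj_left:
  assumes "v \<in> bounded_measurable M"
  shows "ip M (proj u) v = (\<Sum>k\<in>I. ip M u (\<psi> k) * ip M (\<phi> k) v)"
  unfolding proj_def[abs_def] using assms by (intro ip_sum_left basis_bounded)

lemma ip_dual_left:
  assumes "k \<in> I" "v \<in> bounded_measurable M"
  shows "ip M (\<psi> k) v = (\<Sum>l\<in>I. c k l * ip M (\<phi> l) v)"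
  unfolding dual_expansion[OF assms(1)] using assms by (intro ip_sum_left basis_bounded)

lemma ip_dual_right:
  assumes "k \<in> I" "v \<in> bounded_measurable M"
  shows "ip M v (\<psi> k) = (\<Sum>l\<in>I. c l k * ip M v (\<phi> l))"
proof -
  have "ip M v (\<psi> k) = (\<Sum>l\<in>I. cnj (c k l) * ip M v (\<phi> l))"
    unfolding dual_expansion[OF assms(1)] using assms by (intro ip_sum_right basis_bounded)
  then show ?thesis
    using assms(1) by (simp add: dual_coefficient_hermitian)
qed

text \<open>Both sides are the form with kernel \<open>c\<close> evaluated at the numbers
  \<open>ip M u (\<phi> l)\<close> and \<open>ip M (\<phi> k) v\<close>. Since \<open>c\<close> is
  Hermitian, the double sum can be collected into dual functions on either side.\<close>

lemma proj_self_adjoint: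
  assumes "u \<in> bounded_measurable M" "v \<in> bounded_measurable M"
  shows "ip M (proj u) v = ip M u (proj v)"
proof -
  have "ip M (proj u) v = (\<Sum>k\<in>I. \<Sum>l\<in>I. c l k * ip M u (\<phi> l) * ip M (\<phi> k) v)"
    using assms by (simp add: ip_proj_left ip_dual_right sum_distrib_right)
  also have "\<dots> = (\<Sum>l\<in>I. \<Sum>k\<in>I. c l k * ip M u (\<phi> l) * ip M (\<phi> k) v)"
    by (rule sum.swap)
  also have "\<dots> = (\<Sum>l\<in>I. ip M (\<psi> l) v * ip M u (\<phi> l))"
    using assms by (simp add: ip_dual_left sum_distrib_left sum_distrib_right mult_ac)
  also have "\<dots> = (\<Sum>l\<in>I. cnj (ip M v (\<psi> l)) * ip M u (\<phi> l))"
    by (simp add: cnj_ip)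
  also have "\<dots> = ip M u (proj v)"
    unfolding proj_def[abs_def] using assms by (intro ip_sum_right[symmetric] basis_bounded)
  finally show ?thesis .
qed

lemma ip_proj_dual: "k \<in> I \<Longrightarrow> ip M (proj u) (\<psi> k) = ip M u (\<psi> k)"
  using finite_index by (simp add: ip_proj_left dual_bounded biorthogonal mult_delta_right)

lemma proj_proj: "proj (proj u) = proj u"
  unfolding proj_def[of "proj u", abs_def] proj_def[of u, abs_def, symmetric]
  by (simp add: fun_eq_iff ip_proj_dual) (simp add: proj_def)

lemma proj_basis: "j \<in> I \<Longrightarrow> proj (\<phi> j) = \<phi> j"
  using finite_index by (simp add: fun_eq_iff proj_def biorthogonal mult_delta_left)

text \<open>Pythagoras: by self-adjointness and idempotence both cross terms equal the squared norm
  of \<open>proj u\<close>, which is therefore exactly what is subtracted.\<close>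

lemma norm_minus_proj_le:
  assumes u: "u \<in> bounded_measurable M"
  shows "(LINT x|M. (cmod (u x - proj u x))\<^sup>2) \<le> (LINT x|M. (cmod (u x))\<^sup>2)"
proof -
  note b = u proj_bounded[of u] bounded_measurable_diff[OF u proj_bounded[of u]]
  have "ip M (proj u) (proj u) = ip M u (proj u)" "ip M (proj u) u = ip M u (proj u)"
    using proj_self_adjoint[OF u proj_bounded[of u]] proj_self_adjoint[OF u u] by (simp_all add: proj_proj)
  then have "ip M (\<lambda>x. u x - proj u x) (\<lambda>x. u x - proj u x) = ip M u u - ip M (proj u) (proj u)"
    by (simp add: ip_diff_left[OF b(1,2,3)] ip_diff_right[OF b(1,2,1)] ip_diff_right[OF b(1,2,2)])
  then have "(LINT x|M. (cmod (u x - proj u x))\<^sup>2)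
      = (LINT x|M. (cmod (u x))\<^sup>2) - (LINT x|M. (cmod (proj u x))\<^sup>2)"
    unfolding ip_self of_real_diff[symmetric] of_real_eq_iff .
  moreover have "0 \<le> (LINT x|M. (cmod (proj u x))\<^sup>2)"
    by (intro integral_nonneg_AE) auto
  ultimately show ?thesis by simp
qed

definition restricted :: "'a set \<Rightarrow> 'i \<Rightarrow> 'a \<Rightarrow> complex" where
  "restricted \<Omega> j x = indicator \<Omega> x * \<phi> j x"

text \<open>
  In both settings of the theorem the columns of the residual \<open>A - A Z\<^sup>* A\<close> are read off this function:
  its values on the grid, respectively its inner products with the basis.
\<close>

definition residual :: "'a set \<Rightarrow> 'i \<Rightarrow> 'a \<Rightarrow> complex" where
  "residual \<Omega> j x = indicator \<Omega> x * (restricted \<Omega> j x - proj (restricted \<Omega> j) x)"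

lemma restricted_bounded:
  assumes "\<Omega> \<in> sets M" "j \<in> I"
  shows "restricted \<Omega> j \<in> bounded_measurable M"
  unfolding restricted_def[abs_def] using assms by (intro bounded_measurable_intros basis_bounded)

lemma residual_bounded:
  assumes "\<Omega> \<in> sets M" "j \<in> I"
  shows "residual \<Omega> j \<in> bounded_measurable M"
  unfolding residual_def[abs_def] using assms
  by (intro bounded_measurable_mult bounded_measurable_diff bounded_measurable_indicator
      restricted_bounded proj_bounded)

lemma norm_residual_le:
  assumes \<Omega>: "\<Omega> \<in> sets M" and j: "j \<in> I"
  shows "(LINT x|M. (cmod (residual \<Omega> j x))\<^sup>2) \<le> (LINT x|M. (cmod (\<phi> j x))\<^sup>2)"
proof -
  note b = restricted_bounded[OF assms] residual_bounded[OF assms] proj_bounded basis_bounded[OF j]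
  have "(LINT x|M. (cmod (residual \<Omega> j x))\<^sup>2)
      \<le> (LINT x|M. (cmod (restricted \<Omega> j x - proj (restricted \<Omega> j) x))\<^sup>2)"
  proof (rule integral_mono)
    show "(cmod (residual \<Omega> j x))\<^sup>2 \<le> (cmod (restricted \<Omega> j x - proj (restricted \<Omega> j) x))\<^sup>2" for x
      by (simp add: residual_def indicator_def)
  qed (intro integrable_norm_square bounded_measurable_diff b)+
  also have "\<dots> \<le> (LINT x|M. (cmod (restricted \<Omega> j x))\<^sup>2)"
    by (rule norm_minus_proj_le[OF b(1)])
  also have "\<dots> \<le> (LINT x|M. (cmod (\<phi> j x))\<^sup>2)"
  proof (rule integral_mono)
    show "(cmod (restricted \<Omega> j x))\<^sup>2 \<le> (cmod (\<phi> j x))\<^sup>2" for x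
      by (simp add: restricted_def indicator_def)
  qed (intro integrable_norm_square b)+
  finally show ?thesis .
qed

text \<open>The support conditions control a basis function only on the cube or the grid, while the
  functions are defined on the whole space; the projection sees them only through integrals over
  \<open>space M\<close>.\<close>

lemma proj_cong:
  assumes "\<And>x. x \<in> space M \<Longrightarrow> u x = v x"
  shows "proj u = proj v"
proof -
  have "ip M u f = ip M v f" for f
    unfolding ip_def using assms by (intro Bochner_Integration.integral_cong) auto
  then show ?thesis by (simp add: proj_def fun_eq_iff)
qed

lemma residual_eq_0:
  assumes j: "j \<in> I" and x: "x \<in> space M"
    and "(\<forall>x\<in>space M \<inter> \<Omega>. \<phi> j x = 0) \<or> (\<forall>x\<in>space M - \<Omega>. \<phi> j x = 0)"
  shows "residual \<Omega> j x = 0"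
  using assms(3)
proof
  assume "\<forall>x\<in>space M \<inter> \<Omega>. \<phi> j x = 0"
  then have 0: "restricted \<Omega> j x = 0" if "x \<in> space M" for x
    using that by (auto simp: restricted_def indicator_def)
  then have "proj (restricted \<Omega> j) = proj (\<lambda>x. 0)" by (intro proj_cong)
  then show ?thesis using x 0 by (simp add: residual_def proj_def ip_def)
next
  assume "\<forall>x\<in>space M - \<Omega>. \<phi> j x = 0"
  then have eq: "restricted \<Omega> j x = \<phi> j x" if "x \<in> space M" for x
    using that by (auto simp: restricted_def indicator_def)
  then have "proj (restricted \<Omega> j) = proj (\<phi> j)" by (intro proj_cong)
  then show ?thesis using x j eq by (simp add: residual_def proj_basis)
qed

lemma residual_eq_sampled:
  assumes "x \<in> space M" "x \<in> \<Omega>"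
  shows "residual \<Omega> j x = \<phi> j x - (\<Sum>k\<in>I. \<phi> k x * ip M (restricted \<Omega> j) (\<psi> k))"
  using assms by (simp add: residual_def restricted_def[of \<Omega> j x] proj_def mult.commute)

text \<open>The indicator is real and idempotent, so it moves freely between the arguments of
  \<open>ip\<close>: \<open>a k l\<close> is also the inner product of the cut-off
  \<open>\<phi> k\<close> with the full \<open>\<phi> l\<close>. The inner sum is
  \<open>ip M (\<psi> k)\<close> of the cut-off \<open>\<phi> j\<close>, the conjugate of a
  coefficient of its projection, as the conjugate-linear second slot demands.\<close>

lemma residual_eq_gram:
  assumes \<Omega>: "\<Omega> \<in> sets M" and i: "i \<in> I" and j: "j \<in> I"
  defines "a \<equiv> \<lambda>k l. ip M (\<phi> k) (restricted \<Omega> l)"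
  shows "ip M (\<phi> i) (residual \<Omega> j) = a i j - (\<Sum>k\<in>I. a i k * (\<Sum>m\<in>I. cnj (c m k) * a m j))"
proof -
  let ?u = "restricted \<Omega>"
  note b = restricted_bounded[OF \<Omega>]
  have swap: "ip M (?u i) f = ip M (\<phi> i) (\<lambda>x. indicator \<Omega> x * f x)" for i f
    unfolding ip_def restricted_def[abs_def]
    by (intro Bochner_Integration.integral_cong refl) (auto simp: indicator_def)
  have idem: "(\<lambda>x. indicator \<Omega> x * ?u j x) = ?u j"
    by (auto simp: restricted_def indicator_def)
  have a_alt: "a k l = ip M (?u k) (\<phi> l)" for k l
    unfolding a_def swap by (simp add: restricted_def[abs_def])
  have inner: "(\<Sum>m\<in>I. cnj (c m k) * a m j) = ip M (\<psi> k) (?u j)" if k: "k \<in> I" for k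
    using k b[OF j] by (simp add: dual_coefficient_hermitian ip_dual_left a_def)
  have "ip M (\<phi> i) (residual \<Omega> j) = ip M (?u i) (\<lambda>x. ?u j x - proj (?u j) x)"
    unfolding swap residual_def[abs_def] by simp
  also have "\<dots> = ip M (?u i) (?u j) - ip M (?u i) (proj (?u j))"
    using b i j by (intro ip_diff_right proj_bounded)
  also have "ip M (?u i) (?u j) = a i j"
    unfolding swap idem a_def ..
  also have "ip M (?u i) (proj (?u j)) = (\<Sum>k\<in>I. cnj (ip M (?u j) (\<psi> k)) * ip M (?u i) (\<phi> k))"
    unfolding proj_def[abs_def] using b i by (intro ip_sum_right basis_bounded)
  also have "\<dots> = (\<Sum>k\<in>I. a i k * ip M (\<psi> k) (?u j))"
    by (simp add: a_alt cnj_ip mult.commute)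
  also have "\<dots> = (\<Sum>k\<in>I. a i k * (\<Sum>m\<in>I. cnj (c m k) * a m j))"
    by (simp add: inner)
  finally show ?thesis .
qed

end

section \<open>B-splines on the line\<close>

lemma integrable_window:
  fixes f :: "real \<Rightarrow> real"
  assumes "f \<in> borel_measurable borel" "\<And>s. \<bar>f s\<bar> \<le> B"
  shows "integrable lborel (\<lambda>s. f s * indicator {a<..b} s)"
proof (rule Bochner_Integration.integrable_bound)
  show "integrable lborel (\<lambda>s. B * indicator {a<..b} s :: real)"
    by (cases "a \<le> b") (auto intro!: integrable_mult_right integrable_real_indicator)
  have "0 \<le> B" using assms(2)[of 0] by linarith
  then show "AE s in lborel. norm (f s * indicator {a<..b} s) \<le> norm (B * indicator {a<..b} s :: real)"
    using assms(2) by (auto simp: indicator_def)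
qed (use assms(1) in measurable)

text \<open>Reflection turns the interval closed on the left in \<open>bspline0\<close> into a
  window closed on the right; hence the half-open windows used throughout.\<close>

lemma bspline_Suc_window:
  "bspline (Suc p) t = (LINT s|lborel. bspline p s * indicator {t - 1/2<..t + 1/2} s)"
  unfolding bspline.simps convolution_def
  by (intro Bochner_Integration.integral_cong refl) (auto simp: bspline0_def indicator_def)

lemma window_measurable:
  fixes f :: "real \<Rightarrow> real"
  assumes [measurable]: "f \<in> borel_measurable borel"
  shows "(\<lambda>t. LINT s|lborel. f s * indicator {t - 1/2<..t + 1/2} s) \<in> borel_measurable borel"
proof -
  have "(\<lambda>t. LINT s|lborel. f s * (if t - 1/2 < s \<and> s \<le> t + 1/2 then 1 else 0)) \<in> borel_measurable borel"
    by measurable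
  then show ?thesis by (simp add: indicator_def)
qed

lemma bspline_measurable [measurable]: "bspline p \<in> borel_measurable borel"
proof (induction p)
  case 0
  show ?case by (simp add: bspline0_def)
next
  case (Suc p)
  have "bspline (Suc p) = (\<lambda>t. LINT s|lborel. bspline p s * indicator {t - 1/2<..t + 1/2} s)"
    using bspline_Suc_window by blast
  then show ?case using window_measurable[OF Suc] by simp
qed

lemma bspline_bounds: "0 \<le> bspline p t \<and> bspline p t \<le> 1"
proof (induction p arbitrary: t)
  case 0
  show ?case by (simp add: bspline0_def)
next
  case (Suc p)
  have "bspline (Suc p) t \<le> (LINT s|lborel. 1 * indicator {t - 1/2<..t + 1/2} s)"
    unfolding bspline_Suc_window using Suc
    by (intro integral_mono integrable_window[where B = 1] mult_right_mono) auto
  moreover have "0 \<le> bspline (Suc p) t"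
    unfolding bspline_Suc_window using Suc by (intro integral_nonneg_AE) auto
  ultimately show ?case by (simp del: bspline.simps)
qed

lemma bspline_eq_0: "(real p + 1) / 2 < \<bar>t\<bar> \<Longrightarrow> bspline p t = 0"
proof (induction p arbitrary: t)
  case 0
  then show ?case by (auto simp: bspline0_def indicator_def)
next
  case (Suc p)
  have "(\<lambda>s. bspline p s * indicator {t - 1/2<..t + 1/2} s) = (\<lambda>s. 0)"
  proof
    fix s
    show "bspline p s * indicator {t - 1/2<..t + 1/2} s = 0"
      using Suc.prems by (cases "s \<in> {t - 1/2<..t + 1/2}") (auto intro!: Suc.IH)
  qed
  then show ?case unfolding bspline_Suc_window by simp
qed

lemma bspline0_right_continuous: "(bspline0 \<longlongrightarrow> bspline0 t) (at_right t)"
proof -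
  have "eventually (\<lambda>s. bspline0 s = bspline0 t) (at_right t)"
  proof -
    consider "t < -1/2" | "-1/2 \<le> t" "t < 1/2" | "1/2 \<le> t" by linarith
    then show ?thesis
    proof cases
      case 1
      have "eventually (\<lambda>s. s < -1/2) (at_right t)"
        using 1 by (auto simp: eventually_at_right_field)
      then show ?thesis by eventually_elim (use 1 in \<open>auto simp: bspline0_def\<close>)
    next
      case 2
      have "eventually (\<lambda>s. s < 1/2) (at_right t)" "eventually (\<lambda>s. t < s) (at_right t)"
        using 2 by (auto simp: eventually_at_right_less eventually_at_right_field intro!: exI[of _ "1/2"])
      then show ?thesis by eventually_elim (use 2 in \<open>auto simp: bspline0_def\<close>)
    next
      case 3
      have "eventually (\<lambda>s. t < s) (at_right t)" by (simp add: eventually_at_right_less)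
      then show ?thesis by eventually_elim (use 3 in \<open>auto simp: bspline0_def\<close>)
    qed
  qed
  then show ?thesis by (rule tendsto_eventually)
qed

text \<open>Continuity fails for \<open>p = 0\<close>; right continuity holds in every degree and is
  enough to pass from vanishing integrals to vanishing values. For positive degree it is inherited
  from the box factor of the convolution by dominated convergence.\<close>

lemma bspline_right_continuous: "(bspline p \<longlongrightarrow> bspline p t) (at_right t)"
proof (cases p)
  case 0
  then show ?thesis using bspline0_right_continuous[of t] by simp
next
  case (Suc p')
  show ?thesis
  proof (rule tendsto_at_right_sequentially[of t "t + 1"])
    fix S assume S: "\<And>n. t < S n" "\<And>n. S n < t + 1" "S \<longlonglongrightarrow> t"
    have "(\<lambda>n. LINT s|lborel. bspline p' s * bspline0 (S n - s))
        \<longlonglongrightarrow> (LINT s|lborel. bspline p' s * bspline0 (t - s))"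
    \<comment> \<open>As \<open>S n\<close> stays between \<open>t\<close> and \<open>t + 1\<close>,
      this one window contains the support of \<open>bspline0 (S n - s)\<close> in \<open>s\<close>
      for all \<open>n\<close>.\<close>
    proof (rule integral_dominated_convergence[where w = "\<lambda>s. 1 * indicator {t - 1<..t + 2} s"])
      show "integrable lborel (\<lambda>s. 1 * indicator {t - 1<..t + 2} s :: real)"
        by (rule integrable_window) auto
      show "AE s in lborel. (\<lambda>n. bspline p' s * bspline0 (S n - s))
          \<longlonglongrightarrow> bspline p' s * bspline0 (t - s)"
      proof (rule AE_I2)
        fix s
        have "filterlim (\<lambda>n. S n - s) (at_right (t - s)) sequentially"
          using S by (auto simp: filterlim_at intro!: tendsto_intros eventuallyI)
        then have "(\<lambda>n. bspline0 (S n - s)) \<longlonglongrightarrow> bspline0 (t - s)"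
          using bspline0_right_continuous by (rule filterlim_compose[rotated])
        then show "(\<lambda>n. bspline p' s * bspline0 (S n - s)) \<longlonglongrightarrow> bspline p' s * bspline0 (t - s)"
          by (intro tendsto_intros)
      qed
      show "AE s in lborel. norm (bspline p' s * bspline0 (S n - s)) \<le> 1 * indicator {t - 1<..t + 2} s" for n
      proof (rule AE_I2)
        fix s
        have "0 \<le> bspline p' s" "bspline p' s \<le> 1" using bspline_bounds[of p' s] by auto
        then show "norm (bspline p' s * bspline0 (S n - s)) \<le> 1 * indicator {t - 1<..t + 2} s"
          using S(1)[of n] S(2)[of n] by (auto simp: bspline0_def indicator_def)
      qed
    qed (simp_all add: bspline0_def)
    then show "(\<lambda>n. bspline p (S n)) \<longlonglongrightarrow> bspline p t"
      by (simp add: Suc convolution_def)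
  qed simp
qed

text \<open>A cardinal spline series. At each point only finitely many terms are non-zero, so the
  infinite sum is a finite one for arbitrary coefficients.\<close>

definition spline :: "nat \<Rightarrow> (int \<Rightarrow> real) \<Rightarrow> real \<Rightarrow> real" where
  "spline p c x = (\<Sum>\<^sub>\<infinity>k\<in>UNIV. c k * bspline p (x - of_int k))"

text \<open>The generous bound on \<open>K\<close> lets one finite range serve a whole neighbourhood
  or window around a point.\<close>

lemma spline_eq_sum:
  assumes "\<bar>x\<bar> + real p + 1 \<le> of_int K"
  shows "spline p c x = (\<Sum>k\<in>{-K..K}. c k * bspline p (x - of_int k))"
proof -
  have "spline p c x = (\<Sum>\<^sub>\<infinity>k\<in>{-K..K}. c k * bspline p (x - of_int k))"
    unfolding spline_def
  proof (rule infsum_cong_neutral)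
    fix k assume "k \<in> UNIV - {-K..K}"
    then have "K < \<bar>k\<bar>" by auto
    then have "of_int K < \<bar>of_int k :: real\<bar>" by linarith
    then have "real p + 1 < \<bar>x - of_int k\<bar>" using assms by linarith
    then have "(real p + 1) / 2 < \<bar>x - of_int k\<bar>" by simp
    then show "c k * bspline p (x - of_int k) = 0" by (simp add: bspline_eq_0)
  qed auto
  then show ?thesis by simp
qed

lemma spline_0: "spline 0 c x = c \<lfloor>x + 1/2\<rfloor>"
proof -
  have "spline 0 c x = (\<Sum>\<^sub>\<infinity>k\<in>{\<lfloor>x + 1/2\<rfloor>}. c k * bspline 0 (x - of_int k))"
    unfolding spline_def
  proof (rule infsum_cong_neutral)
    fix k assume "k \<in> UNIV - {\<lfloor>x + 1/2\<rfloor>}"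
    then have "x - of_int k \<notin> {-1/2..<1/2}" by (auto; linarith)
    then show "c k * bspline 0 (x - of_int k) = 0" by (simp add: bspline0_def)
  qed auto
  moreover have "x - of_int \<lfloor>x + 1/2\<rfloor> \<in> {-1/2..<1/2}" by auto linarith+
  then have "bspline 0 (x - of_int \<lfloor>x + 1/2\<rfloor>) = 1" by (simp add: bspline0_def)
  ultimately show ?thesis by simp
qed

lemma integral_window_translate:
  fixes f :: "real \<Rightarrow> real"
  shows "(LINT s|lborel. f s * indicator {a - u<..b - u} s) = (LINT s|lborel. f (s - u) * indicator {a<..b} s)"
  by (subst lborel_integral_real_affine[of 1 _ "-u"])
     (auto simp: indicator_def algebra_simps intro!: Bochner_Integration.integral_cong)

text \<open>Convolution with the box raises the degree and leaves the coefficients unchanged, so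
  inductions on the degree can run over whole series.\<close>

lemma spline_Suc:
  "spline (Suc p) c x = (LINT s|lborel. spline p c s * indicator {x - 1/2<..x + 1/2} s)"
proof -
  define K where "K = \<lceil>\<bar>x\<bar> + real p + 2\<rceil>"
  have K: "\<bar>x\<bar> + real p + 2 \<le> of_int K" unfolding K_def by linarith
  have int: "integrable lborel (\<lambda>s. c k * (bspline p (s - of_int k) * indicator {x - 1/2<..x + 1/2} s))" for k
    using bspline_bounds by (intro integrable_mult_right integrable_window[where B = 1]) auto
  have "spline (Suc p) c x = (\<Sum>k\<in>{-K..K}. c k * bspline (Suc p) (x - of_int k))"
    using K by (intro spline_eq_sum) simp
  also have "\<dots> = (\<Sum>k\<in>{-K..K}. c k * (LINT s|lborel. bspline p (s - of_int k) * indicator {x - 1/2<..x + 1/2} s))"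
    unfolding bspline_Suc_window
    using integral_window_translate[of "bspline p" "x - 1/2" _ "x + 1/2"]
    by (simp add: algebra_simps)
  also have "\<dots> = (LINT s|lborel. (\<Sum>k\<in>{-K..K}. c k * (bspline p (s - of_int k) * indicator {x - 1/2<..x + 1/2} s)))"
    using int by (subst Bochner_Integration.integral_sum) auto
  also have "\<dots> = (LINT s|lborel. spline p c s * indicator {x - 1/2<..x + 1/2} s)"
  proof (intro Bochner_Integration.integral_cong refl)
    fix s
    show "(\<Sum>k\<in>{-K..K}. c k * (bspline p (s - of_int k) * indicator {x - 1/2<..x + 1/2} s))
        = spline p c s * indicator {x - 1/2<..x + 1/2} s"
    proof (cases "s \<in> {x - 1/2<..x + 1/2}")
      case True
      then have "\<bar>s\<bar> + real p + 1 \<le> of_int K" using K by auto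
      then show ?thesis by (simp add: spline_eq_sum sum_distrib_right mult.assoc)
    qed simp
  qed
  finally show ?thesis .
qed

lemma spline_measurable [measurable]: "spline p c \<in> borel_measurable borel"
proof (induction p)
  case 0
  have "spline 0 c = (\<lambda>x. c \<lfloor>x + 1/2\<rfloor>)" by (simp add: spline_0 fun_eq_iff)
  then show ?case by simp
next
  case (Suc p)
  have "spline (Suc p) c = (\<lambda>t. LINT s|lborel. spline p c s * indicator {t - 1/2<..t + 1/2} s)"
    using spline_Suc by blast
  then show ?case using window_measurable[OF Suc] by simp
qed

text \<open>Partition of unity: the windows have length 1, so averaging the constant 1 reproduces it
  in every degree.\<close>

lemma spline_one: "spline p (\<lambda>_. 1) x = 1"
proof (induction p arbitrary: x)
  case 0
  show ?case by (simp add: spline_0)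
next
  case (Suc p)
  then show ?case by (simp add: spline_Suc)
qed

lemma spline_translate: "spline p c (x + of_int m) = spline p (\<lambda>k. c (k + m)) x"
proof -
  have "bij_betw (\<lambda>k. k + m) UNIV UNIV"
    by (rule bij_betw_byWitness[where f' = "\<lambda>k. k - m"]) auto
  from infsum_reindex_bij_betw[OF this, of "\<lambda>k. c k * bspline p (x + of_int m - of_int k)"]
  show ?thesis by (simp add: spline_def)
qed

lemma spline_sum: "spline p (\<lambda>k. \<Sum>i\<in>I. a i * c i k) x = (\<Sum>i\<in>I. a i * spline p (c i) x)"
proof -
  define K where "K = \<lceil>\<bar>x\<bar> + real p + 1\<rceil>"
  have K: "\<bar>x\<bar> + real p + 1 \<le> of_int K" unfolding K_def by linarith
  have "(\<Sum>k\<in>{-K..K}. (\<Sum>i\<in>I. a i * c i k) * bspline p (x - of_int k))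
      = (\<Sum>k\<in>{-K..K}. \<Sum>i\<in>I. a i * (c i k * bspline p (x - of_int k)))"
    by (simp add: sum_distrib_right mult.assoc)
  also have "\<dots> = (\<Sum>i\<in>I. a i * (\<Sum>k\<in>{-K..K}. c i k * bspline p (x - of_int k)))"
    by (subst sum.swap) (simp add: sum_distrib_left)
  finally show ?thesis by (simp add: spline_eq_sum[OF K])
qed

lemma spline_const: "spline p (\<lambda>_. b) x = b"
  using spline_sum[where I = "{()}" and a = "\<lambda>_. b" and c = "\<lambda>_ _. 1"] by (simp add: spline_one)

lemma spline_diff: "spline p (\<lambda>k. c k - d k) x = spline p c x - spline p d x"
proof -
  define K where "K = \<lceil>\<bar>x\<bar> + real p + 1\<rceil>"
  have K: "\<bar>x\<bar> + real p + 1 \<le> of_int K" unfolding K_def by linarith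
  show ?thesis by (simp add: spline_eq_sum[OF K] left_diff_distrib sum_subtractf)
qed

lemma spline_nonneg: "(\<And>k. 0 \<le> c k) \<Longrightarrow> 0 \<le> spline p c x"
  unfolding spline_def using bspline_bounds by (intro infsum_nonneg mult_nonneg_nonneg) auto

text \<open>Values are averages of coefficients with non-negative weights of total 1: positivity is
  applied to \<open>B - c k\<close> and to \<open>c k + B\<close>.\<close>

lemma spline_abs_le:
  assumes "\<And>k. \<bar>c k\<bar> \<le> B"
  shows "\<bar>spline p c x\<bar> \<le> B"
proof -
  have "0 \<le> B - c k" "0 \<le> c k - (- B)" for k using assms[of k] by linarith+
  then have "0 \<le> spline p (\<lambda>k. B - c k) x" "0 \<le> spline p (\<lambda>k. c k - (- B)) x"
    by (intro spline_nonneg; blast)+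
  then show ?thesis unfolding spline_diff spline_const by linarith
qed

lemma spline_right_continuous: "(spline p c \<longlongrightarrow> spline p c x) (at_right x)"
proof -
  define K where "K = \<lceil>\<bar>x\<bar> + real p + 2\<rceil>"
  have K: "\<bar>x\<bar> + real p + 2 \<le> of_int K" unfolding K_def by linarith
  have eq: "spline p c y = (\<Sum>k\<in>{-K..K}. c k * bspline p (y - of_int k))" if "\<bar>y - x\<bar> < 1" for y
    using that K by (intro spline_eq_sum) linarith
  have "((\<lambda>y. \<Sum>k\<in>{-K..K}. c k * bspline p (y - of_int k)) \<longlongrightarrow>
      (\<Sum>k\<in>{-K..K}. c k * bspline p (x - of_int k))) (at_right x)"
  proof (intro tendsto_sum tendsto_mult tendsto_const)
    fix k
    have "eventually (\<lambda>y. x < y \<and> y \<noteq> x) (at_right x)"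
      using eventually_at_right_less[of x] by eventually_elim simp
    then have "filterlim (\<lambda>y. y - of_int k) (at_right (x - of_int k)) (at_right x)"
      by (auto simp: filterlim_at intro!: tendsto_intros)
    then show "((\<lambda>y. bspline p (y - of_int k)) \<longlongrightarrow> bspline p (x - of_int k)) (at_right x)"
      using bspline_right_continuous by (rule filterlim_compose[rotated])
  qed
  moreover have "eventually (\<lambda>y. y \<in> {x<..<x + 1}) (at_right x)"
    by (rule eventually_at_right_real) simp
  then have "eventually (\<lambda>y. (\<Sum>k\<in>{-K..K}. c k * bspline p (y - of_int k)) = spline p c y) (at_right x)"
    by eventually_elim (rule eq[symmetric], auto)
  ultimately show ?thesis
    by (subst eq) (auto intro: Lim_transform_eventually)
qed

text \<open>After multiplication by the sign of \<open>f x\<close>, the function exceeds half of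
  \<open>\<bar>f x\<bar>\<close> on a short interval to the right of \<open>x\<close>, so its
  integral over a window there would be positive.\<close>

lemma right_continuous_eq_0I:
  fixes f :: "real \<Rightarrow> real"
  assumes f: "f \<in> borel_measurable borel" "\<And>s. \<bar>f s\<bar> \<le> B"
    and lim: "(f \<longlongrightarrow> f x) (at_right x)" and "d > 0"
    and zero: "\<And>h. 0 < h \<Longrightarrow> h < d \<Longrightarrow> (LINT s|lborel. f s * indicator {x<..x + h} s) = 0"
  shows "f x = 0"
proof (rule ccontr)
  assume "f x \<noteq> 0"
  define F where "F s = f s * sgn (f x)" for s
  have Fx: "F x > 0" using \<open>f x \<noteq> 0\<close> by (simp add: F_def flip: abs_sgn)
  have "(F \<longlongrightarrow> F x) (at_right x)" unfolding F_def by (intro tendsto_intros lim)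
  then have "eventually (\<lambda>s. F x / 2 < F s) (at_right x)"
    using Fx by (intro order_tendstoD) auto
  then obtain b where b: "b > x" "\<And>s. x < s \<Longrightarrow> s < b \<Longrightarrow> F x / 2 < F s"
    by (auto simp: eventually_at_right_field)
  define h where "h = min (b - x) d / 2"
  have h: "0 < h" "h < d" "x + h < b" using b \<open>d > 0\<close> by (auto simp: h_def min_def field_simps)
  have "F x / 2 * h = (LINT s|lborel. F x / 2 * indicator {x<..x + h} s)"
    using h by simp
  also have "\<dots> \<le> (LINT s|lborel. F s * indicator {x<..x + h} s)"
  proof (rule integral_mono)
    have [measurable]: "f \<in> borel_measurable borel" by fact
    show "integrable lborel (\<lambda>s. F s * indicator {x<..x + h} s)"
      unfolding F_def using f(2) order_trans[OF abs_ge_zero f(2)]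
      by (intro integrable_window[where B = B]) (auto simp: abs_mult sgn_real_def)
    show "F x / 2 * indicator {x<..x + h} s \<le> F s * indicator {x<..x + h} s" for s
      using b(2)[of s] h by (auto simp: indicator_def)
  qed (rule integrable_window[where B = "F x / 2"], use Fx in auto)
  also have "\<dots> = (LINT s|lborel. sgn (f x) * (f s * indicator {x<..x + h} s))"
    by (simp add: F_def mult_ac)
  also have "\<dots> = 0" using zero[OF h(1,2)] by simp
  finally show False using Fx h by (simp add: mult_le_0_iff)
qed

text \<open>
  Vanishing of all window integrals makes \<open>spline p c\<close> 1-periodic, so the differences of \<open>c\<close> vanish
  by induction; a constant \<open>c\<close> is then determined by the partition of unity.
\<close>

lemma spline_eq_0_imp:
  assumes "\<And>x. spline p c x = 0" "\<And>k. \<bar>c k\<bar> \<le> B"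
  shows "c k = 0"
  using assms
proof (induction p arbitrary: c B k)
  case 0
  have "spline 0 c (of_int k) = c k"
    unfolding spline_0 by (rule arg_cong[where f = c]) linarith
  then show ?case using 0 by simp
next
  case (Suc p)
  define d where "d k = c (k + 1) - c k" for k
  let ?g = "spline p c"
  note g_le = spline_abs_le[OF Suc.prems(2), of p]
  have d_le: "\<bar>d k\<bar> \<le> 2 * B" for k
    using Suc.prems(2)[of k] Suc.prems(2)[of "k + 1"] unfolding d_def by linarith
  have d_eq: "spline p d x = ?g (x + 1) - ?g x" for x
    using spline_translate[of p c x 1] by (simp add: d_def[abs_def] spline_diff)
  have int: "integrable lborel (\<lambda>s. ?g s * indicator {a<..b} s)"
       "integrable lborel (\<lambda>s. ?g (s + 1) * indicator {a<..b} s)" for a b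
    using g_le by (intro integrable_window[where B = B]; simp)+
  have "spline p d x = 0" for x
  proof (rule right_continuous_eq_0I[where f = "spline p d" and d = 1 and B = "2 * B"])
    fix h :: real assume h: "0 < h" "h < 1"
    have w: "(LINT s|lborel. ?g s * indicator {y<..y + 1} s) = 0" for y
      using spline_Suc[of p c "y + 1/2"] Suc.prems(1)[of "y + 1/2"] by (simp add: add.commute)
    have "(LINT s|lborel. spline p d s * indicator {x<..x + h} s)
      = (LINT s|lborel. ?g (s + 1) * indicator {x<..x + h} s) - (LINT s|lborel. ?g s * indicator {x<..x + h} s)"
      using int by (subst Bochner_Integration.integral_diff[symmetric]) (auto simp: d_eq left_diff_distrib)
    also have "(LINT s|lborel. ?g (s + 1) * indicator {x<..x + h} s)
        = (LINT s|lborel. ?g s * indicator {x + 1<..x + 1 + h} s)"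
      using integral_window_translate[of ?g x "-1" "x + h"] by (simp add: add_ac)
    also have "\<dots> - (LINT s|lborel. ?g s * indicator {x<..x + h} s)
      = (LINT s|lborel. ?g s * indicator {x + 1<..x + 1 + h} s - ?g s * indicator {x<..x + h} s)"
      using int by (intro Bochner_Integration.integral_diff[symmetric])
    \<comment> \<open>Since \<open>h < 1\<close>, both unit windows contain the piece from
      \<open>x + h\<close> to \<open>x + 1\<close>, which cancels. The two short windows thus become
      two windows of length 1, whose integrals vanish.\<close>
    also have "\<dots> = (LINT s|lborel. ?g s * indicator {x + h<..x + h + 1} s - ?g s * indicator {x<..x + 1} s)"
      using h by (intro Bochner_Integration.integral_cong) (auto simp: indicator_def)
    also have "\<dots> = 0"
      using int w by (subst Bochner_Integration.integral_diff) auto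
    finally show "(LINT s|lborel. spline p d s * indicator {x<..x + h} s) = 0" .
  qed (use spline_abs_le[OF d_le] spline_right_continuous in auto)
  then have "d k = 0" for k by (rule Suc.IH[OF _ d_le])
  then have step: "c (k + 1) = c k" for k by (simp add: d_def)
  have const: "c k = c 0" for k
  proof (induction k rule: int_induct[where k = 0])
    case (step2 i)
    then show ?case using step[of "i - 1"] by simp
  qed (use step in auto)
  then have "c = (\<lambda>_. c 0)" by blast
  then have "spline (Suc p) c 0 = c 0" by (metis spline_const)
  then show ?case using Suc.prems(1)[of 0] const[of k] by simp
qed

section \<open>Periodic B-splines and their duals\<close>

text \<open>The basis function on the scale where the grid spacing is 1 and the period is
  \<open>n\<close>. Selecting a residue class of coefficients also covers the case where the
  B-spline is wider than the period and wraps around.\<close>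

definition cyclic_bspline :: "nat \<Rightarrow> nat \<Rightarrow> nat \<Rightarrow> real \<Rightarrow> real" where
  "cyclic_bspline p n k = spline p (\<lambda>j. if j mod int n = int k then 1 else 0)"

text \<open>The shift by \<open>l\<close> periods together with \<open>k / n\<close> is the shift by
  the integer \<open>k + n * l\<close> after scaling, and these integers run once through the
  residue class of \<open>k\<close>.\<close>

lemma phi_eq_cyclic:
  assumes "k < n"
  shows "phi p n k t = complex_of_real (sqrt (real n) * cyclic_bspline p n k (real n * t))"
proof -
  define f where "f j = bspline p (real n * t - of_int j)" for j :: int
  have range: "range (\<lambda>l. int k + int n * l) = {j. j mod int n = int k}"
  proof (intro subset_antisym subsetI)
    fix j assume "j \<in> {j. j mod int n = int k}"
    then have "j = int k + int n * (j div int n)"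
      using mult_div_mod_eq[of "int n" j] by simp
    then show "j \<in> range (\<lambda>l. int k + int n * l)" by blast
  qed (use assms in auto)
  have inj: "inj (\<lambda>l. int k + int n * l)"
    using assms by (auto intro: injI)
  have "real n * (t - real k / real n - of_int l) = real n * t - of_int (int k + int n * l)" for l
    using assms by (simp add: right_diff_distrib)
  then have "periodic_bspline p n (t - real k / real n) = (\<Sum>\<^sub>\<infinity>l. sqrt (real n) * f (int k + int n * l))"
    unfolding periodic_bspline_def f_def by simp
  also have "\<dots> = sqrt (real n) * (\<Sum>\<^sub>\<infinity>l. (f \<circ> (\<lambda>l. int k + int n * l)) l)"
    by (simp add: infsum_cmult_right')
  also have "(\<Sum>\<^sub>\<infinity>l. (f \<circ> (\<lambda>l. int k + int n * l)) l) = infsum f {j. j mod int n = int k}"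
    using infsum_reindex[OF inj, of f] range by (simp add: o_def)
  also have "\<dots> = cyclic_bspline p n k (real n * t)"
    unfolding cyclic_bspline_def spline_def by (rule infsum_cong_neutral) (auto simp: f_def)
  finally show ?thesis by (simp add: phi_def)
qed

lemma sum_cyclic_bspline:
  assumes "n \<ge> 1"
  shows "(\<Sum>k<n. a k * cyclic_bspline p n k x) = spline p (\<lambda>j. a (nat (j mod int n))) x"
proof -
  have "(\<Sum>k<n. a k * (if j mod int n = int k then 1 else 0)) = a (nat (j mod int n))" for j
  proof -
    have "nat (j mod int n) < n" using assms by (simp add: nat_less_iff)
    moreover have "j mod int n = int k \<longleftrightarrow> nat (j mod int n) = k" for k
      using assms by auto
    ultimately show ?thesis by (simp add: mult_delta_right)
  qed
  then show ?thesis by (simp add: cyclic_bspline_def flip: spline_sum)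
qed

lemma cyclic_bspline_partition: "n \<ge> 1 \<Longrightarrow> (\<Sum>k<n. cyclic_bspline p n k x) = 1"
  using sum_cyclic_bspline[of n "\<lambda>_. 1" p x] by (simp add: spline_one)

text \<open>For each integer \<open>i\<close> exactly one \<open>j < n\<close> brings
  \<open>i + j\<close> into the residue class of \<open>k\<close>, so the translated coefficients
  add up to the constant 1. This partition of unity over the translates of a single basis function
  determines both its integral and its grid sum.\<close>

lemma sum_cyclic_bspline_translates:
  assumes "k < n"
  shows "(\<Sum>j<n. cyclic_bspline p n k (x + real j)) = 1"
proof -
  have "(\<Sum>j<n. if (i + int j) mod int n = int k then 1 else 0 :: real) = 1" for i
  proof -
    define j0 where "j0 = nat ((int k - i) mod int n)"
    have "(i + int j) mod int n = int k \<longleftrightarrow> j = j0" if "j < n" for j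
    proof -
      have "(i + int j) mod int n = int k \<longleftrightarrow> (i + int j) mod int n = int k mod int n"
        using assms by simp
      also have "\<dots> \<longleftrightarrow> int j mod int n = (int k - i) mod int n"
        by (simp add: mod_eq_dvd_iff algebra_simps)
      also have "\<dots> \<longleftrightarrow> j = j0"
        using that assms by (auto simp: j0_def)
      finally show ?thesis .
    qed
    moreover have "j0 < n" using assms by (simp add: j0_def nat_less_iff)
    ultimately show ?thesis by simp
  qed
  then have "(\<lambda>i. \<Sum>j<n. 1 * (if (i + int j) mod int n = int k then 1 else 0 :: real)) = (\<lambda>_. 1)"
    by simp
  then have "(\<Sum>j<n. 1 * spline p (\<lambda>i. if (i + int j) mod int n = int k then 1 else 0) x) = 1"
    by (subst spline_sum[symmetric]) (simp only: spline_one)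
  then show ?thesis
    using spline_translate[of p _ x "int j" for j] by (simp add: cyclic_bspline_def)
qed

lemma cyclic_bspline_nonneg: "0 \<le> cyclic_bspline p n k x"
  by (simp add: cyclic_bspline_def spline_nonneg)

lemma cyclic_bspline_le_1: "cyclic_bspline p n k x \<le> 1"
proof -
  have "\<bar>spline p (\<lambda>j. if j mod int n = int k then 1 else 0) x\<bar> \<le> 1"
    by (rule spline_abs_le) simp
  then show ?thesis by (simp add: cyclic_bspline_def)
qed

lemma cyclic_bspline_measurable [measurable]: "cyclic_bspline p n k \<in> borel_measurable borel"
  by (simp add: cyclic_bspline_def)

lemma phi_measurable [measurable]:
  assumes "k < n"
  shows "phi p n k \<in> borel_measurable borel"
proof -
  have "phi p n k = (\<lambda>t. complex_of_real (sqrt (real n) * cyclic_bspline p n k (real n * t)))"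
    using assms by (intro ext phi_eq_cyclic)
  then show ?thesis by simp
qed

lemma norm_phi:
  "k < n \<Longrightarrow> cmod (phi p n k t) = sqrt (real n) * cyclic_bspline p n k (real n * t)"
  by (simp add: phi_eq_cyclic norm_mult cyclic_bspline_nonneg del: of_real_mult)

lemma norm_phi_le: "k < n \<Longrightarrow> cmod (phi p n k t) \<le> sqrt (real n)"
  using cyclic_bspline_le_1 mult_left_mono[of _ 1 "sqrt (real n)"] by (simp add: norm_phi)

lemma sum_norm_phi: "n \<ge> 1 \<Longrightarrow> (\<Sum>k<n. cmod (phi p n k t)) = sqrt (real n)"
  by (simp add: norm_phi cyclic_bspline_partition flip: sum_distrib_left)

section \<open>Norms, linear independence and the dual basis on the unit interval\<close>

abbreviation unit_interval_measure :: "real measure" where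
  "unit_interval_measure \<equiv> restrict_space lborel {0<..<1}"

lemma finite_measure_restrict_lborel:
  "A \<in> sets borel \<Longrightarrow> bounded A \<Longrightarrow> finite_measure (restrict_space lborel A)"
  using emeasure_bounded_finite[of A]
  by (intro finite_measureI) (simp add: emeasure_restrict_space space_restrict_space)

lemma L2_inner_eq_ip:
  "A \<in> sets borel \<Longrightarrow> L2_inner A f g = ip (restrict_space lborel A) f g"
  by (simp add: L2_inner_def ip_def set_lebesgue_integral_def integral_restrict_space)

text \<open>On the scaled line one period splits into \<open>n\<close> unit cells; shifting them all
  to the first cell, the translates sum to 1, so the integral over a period is 1. Scaling back
  divides by \<open>n\<close>, and the normalisation multiplies by the root of
  \<open>n\<close>.\<close>

lemma integral_norm_phi:
  assumes "k < n"
  shows "(LINT t|lborel. indicator {0<..<1} t * cmod (phi p n k t)) = 1 / sqrt (real n)"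
proof -
  let ?b = "cyclic_bspline p n k"
  have [measurable]: "?b \<in> borel_measurable borel" by simp
  have ints: "integrable lborel (\<lambda>x. ?b x * indicator {a<..b} x)" for a b
    using cyclic_bspline_nonneg cyclic_bspline_le_1 by (intro integrable_window[where B = 1]) auto
  have ints': "integrable lborel (\<lambda>x. ?b (x + real j) * indicator {0<..1} x)" for j
    using cyclic_bspline_nonneg cyclic_bspline_le_1 by (intro integrable_window[where B = 1]) auto
  have split: "indicator {0<..real m} x = (\<Sum>j<m. indicator {real j<..real j + 1} x :: real)" for m x
    by (induction m) (auto simp: indicator_def)
  have "(LINT x|lborel. ?b x * indicator {0<..real n} x)
      = (LINT x|lborel. (\<Sum>j<n. ?b x * indicator {real j<..real j + 1} x))"
    by (simp add: split sum_distrib_left)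
  also have "\<dots> = (\<Sum>j<n. LINT x|lborel. ?b x * indicator {real j<..real j + 1} x)"
    using ints by (intro Bochner_Integration.integral_sum)
  also have "\<dots> = (\<Sum>j<n. LINT x|lborel. ?b (x + real j) * indicator {0<..1} x)"
    using integral_window_translate[of ?b 0 "- real j" 1 for j] by (simp add: add.commute)
  also have "\<dots> = (LINT x|lborel. (\<Sum>j<n. ?b (x + real j) * indicator {0<..1} x))"
    using ints' by (intro Bochner_Integration.integral_sum[symmetric])
  also have "\<dots> = (LINT x|lborel. indicator {0<..1::real} x)"
    using assms by (simp add: sum_cyclic_bspline_translates flip: sum_distrib_right)
  finally have "(LINT x|lborel. ?b x * indicator {0<..real n} x) = 1" by simp
  moreover have "(LINT x|lborel. ?b x * indicator {0<..real n} x)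
      = real n * (LINT t|lborel. ?b (real n * t) * indicator {0<..real n} (real n * t))"
    using assms by (subst lborel_integral_real_affine[of "real n" _ 0]) auto
  moreover have "(LINT t|lborel. ?b (real n * t) * indicator {0<..real n} (real n * t))
      = (LINT t|lborel. indicator {0<..<1} t * ?b (real n * t))"
  proof (rule integral_cong_AE)
    have "AE t in lborel. t \<noteq> (1 :: real)" by (rule AE_lborel_singleton)
    then show "AE t in lborel. ?b (real n * t) * indicator {0<..real n} (real n * t)
        = indicator {0<..<1} t * ?b (real n * t)"
      by eventually_elim (use assms in \<open>auto simp: indicator_def mult_le_cancel_left1 zero_less_mult_iff\<close>)
  qed auto
  ultimately have "real n * (LINT t|lborel. indicator {0<..<1} t * ?b (real n * t)) = 1" by simp
  moreover have "(LINT t|lborel. indicator {0<..<1} t * cmod (phi p n k t))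
      = sqrt (real n) * (LINT t|lborel. indicator {0<..<1} t * ?b (real n * t))"
    using assms by (simp add: norm_phi mult.left_commute)
  ultimately have "sqrt (real n) * (LINT t|lborel. indicator {0<..<1} t * cmod (phi p n k t)) = 1"
    by (simp flip: mult.assoc)
  then show ?thesis
    using assms by (simp add: eq_divide_eq mult.commute)
qed

lemma phi_bounded_measurable: "k < n \<Longrightarrow> phi p n k \<in> bounded_measurable unit_interval_measure"
  by (rule bounded_measurableI[where B = "sqrt (real n)"])
     (auto intro: measurable_restrict_space1 norm_phi_le)

text \<open>A zero mean square gives zero values on one period by right continuity, then everywhere
  by periodicity of the coefficients, so that \<open>spline_eq_0_imp\<close> applies.\<close>

lemma periodic_spline_eq_0_imp:
  assumes n: "n \<ge> 1" and B: "\<And>k. \<bar>c k\<bar> \<le> B" and per: "\<And>k. c (k + int n) = c k"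
    and zero: "(LINT t|unit_interval_measure. (spline p c (real n * t))\<^sup>2) = 0"
  shows "c k = 0"
proof (rule spline_eq_0_imp[OF _ B])
  let ?F = "\<lambda>t. (spline p c (real n * t))\<^sup>2"
  have F_le: "\<bar>?F t\<bar> \<le> B\<^sup>2" for t
  proof -
    have "\<bar>spline p c (real n * t)\<bar> \<le> B" by (rule spline_abs_le[OF B])
    then show ?thesis using power_mono[of "\<bar>spline p c (real n * t)\<bar>" B 2] by simp
  qed
  have zero': "(LINT t|lborel. ?F t * indicator {0<..<1} t) = 0"
    using zero by (simp add: integral_restrict_space mult.commute)
  have int: "integrable lborel (\<lambda>t. ?F t * indicator {a<..b} t)" for a b
    using F_le by (intro integrable_window[where B = "B\<^sup>2"]) auto
  have "integrable lborel (\<lambda>t. ?F t * indicator {0<..<1} t)"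
    by (rule Bochner_Integration.integrable_bound[OF int[of 0 1]]) (auto simp: indicator_def)
  note int = int this
  \<comment> \<open>The end point \<open>t = 0\<close> is included: only windows to the right of
    \<open>t\<close> enter, and they stay inside the open unit interval.\<close>
  have base: "spline p c (real n * t) = 0" if t: "0 \<le> t" "t < 1" for t
  proof -
    have "?F t = 0"
    proof (rule right_continuous_eq_0I[where f = ?F and B = "B\<^sup>2" and d = "1 - t"])
      have "eventually (\<lambda>s. real n * t < real n * s \<and> real n * s \<noteq> real n * t) (at_right t)"
        using eventually_at_right_less[of t] by eventually_elim (use n in auto)
      then have "filterlim (\<lambda>s. real n * s) (at_right (real n * t)) (at_right t)"
        by (auto simp: filterlim_at intro!: tendsto_intros elim: eventually_mono)
      then have "((\<lambda>s. spline p c (real n * s)) \<longlongrightarrow> spline p c (real n * t)) (at_right t)"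
        using spline_right_continuous by (rule filterlim_compose[rotated])
      then show "(?F \<longlongrightarrow> ?F t) (at_right t)" by (intro tendsto_intros)
      fix h :: real assume h: "0 < h" "h < 1 - t"
      have "(LINT s|lborel. ?F s * indicator {t<..t + h} s) \<le> (LINT s|lborel. ?F s * indicator {0<..<1} s)"
        using t h by (intro integral_mono int) (auto simp: indicator_def)
      moreover have "0 \<le> (LINT s|lborel. ?F s * indicator {t<..t + h} s)"
        by (intro integral_nonneg_AE) auto
      ultimately show "(LINT s|lborel. ?F s * indicator {t<..t + h} s) = 0"
        using zero' by simp
    qed (use t F_le in auto)
    then show ?thesis by simp
  qed
  have per': "c (k + int n * m) = c k" for k m
  proof (induction m rule: int_induct[where k = 0])
    case (step1 i)
    then show ?case using per[of "k + int n * i"] by (simp add: algebra_simps)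
  next
    case (step2 i)
    then show ?case using per[of "k + int n * (i - 1)"] by (simp add: algebra_simps)
  qed simp
  fix x
  define m where "m = \<lfloor>x / real n\<rfloor>"
  define t where "t = x / real n - of_int m"
  have t: "0 \<le> t" "t < 1" unfolding t_def m_def by linarith+
  have "x = real n * t + of_int (int n * m)"
    using n by (simp add: t_def field_simps)
  then have "spline p c x = spline p (\<lambda>k. c (k + int n * m)) (real n * t)"
    by (metis spline_translate)
  then show "spline p c x = 0" using base[OF t] by (simp add: per')
qed

text \<open>The basis is real-valued, so the real and imaginary parts of a combination are
  themselves real splines with periodic coefficients, each dominated by the modulus of the
  combination; \<open>r\<close> stands for either part.\<close>

lemma phi_linear_independent:
  assumes n: "n \<ge> 1"
    and zero: "(LINT t|unit_interval_measure. (cmod (\<Sum>k<n. a k * phi p n k t))\<^sup>2) = 0"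
  shows "\<forall>k<n. a k = 0"
proof -
  interpret finite_measure unit_interval_measure by (rule finite_measure_restrict_lborel) auto
  let ?f = "\<lambda>t. \<Sum>k<n. a k * phi p n k t"
  have f: "?f \<in> bounded_measurable unit_interval_measure"
    by (intro bounded_measurable_intros phi_bounded_measurable) auto
  note int = integrable_norm_square[OF f]
  have "r (a k) = 0" if r: "r = Re \<or> r = Im" and k: "k < n" for r k
  proof -
    define c where "c j = r (a (nat (j mod int n)))" for j
    have r_sum: "r (\<Sum>k\<in>A. g k) = (\<Sum>k\<in>A. r (g k))" for A and g :: "nat \<Rightarrow> complex"
      using r by auto
    have r_mult: "r (z * of_real y) = r z * y" "(r z)\<^sup>2 \<le> (cmod z)\<^sup>2" for z y
      using r by (auto simp: cmod_power2)
    have r_f: "r (?f t) = sqrt (real n) * spline p c (real n * t)" for t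
    proof -
      have "r (?f t) = (\<Sum>k<n. r (a k) * (sqrt (real n) * cyclic_bspline p n k (real n * t)))"
        by (simp add: r_sum phi_eq_cyclic r_mult del: of_real_mult)
      also have "\<dots> = sqrt (real n) * (\<Sum>k<n. r (a k) * cyclic_bspline p n k (real n * t))"
        by (simp add: sum_distrib_left mult_ac)
      finally show ?thesis
        using sum_cyclic_bspline[OF n, of "\<lambda>k. r (a k)" p "real n * t"] by (simp add: c_def[abs_def])
    qed
    have sq: "real n * (spline p c (real n * t))\<^sup>2 \<le> (cmod (?f t))\<^sup>2" for t
      using r_mult(2)[of "?f t"] by (simp add: r_f power_mult_distrib)
    have "0 \<le> (LINT t|unit_interval_measure. real n * (spline p c (real n * t))\<^sup>2)"
      by (intro integral_nonneg_AE) auto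
    moreover have "(LINT t|unit_interval_measure. real n * (spline p c (real n * t))\<^sup>2)
        \<le> (LINT t|unit_interval_measure. (cmod (?f t))\<^sup>2)"
    proof (rule integral_mono[OF Bochner_Integration.integrable_bound[OF int] int sq])
      show "(\<lambda>t. real n * (spline p c (real n * t))\<^sup>2) \<in> borel_measurable unit_interval_measure"
        by (rule measurable_restrict_space1) simp
      show "AE t in unit_interval_measure. norm (real n * (spline p c (real n * t))\<^sup>2)
          \<le> norm ((cmod (?f t))\<^sup>2)"
        using sq by (intro AE_I2) simp
    qed
    ultimately have "(LINT t|unit_interval_measure. real n * (spline p c (real n * t))\<^sup>2) = 0"
      using zero by linarith
    then have z: "(LINT t|unit_interval_measure. (spline p c (real n * t))\<^sup>2) = 0"
      using n by simp
    have "\<bar>c j\<bar> \<le> (\<Sum>k<n. cmod (a k))" for j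
    proof -
      have "\<bar>c j\<bar> \<le> cmod (a (nat (j mod int n)))"
        using r by (auto simp: c_def abs_Re_le_cmod abs_Im_le_cmod)
      also have "\<dots> \<le> (\<Sum>k<n. cmod (a k))"
        using n by (intro member_le_sum) (auto simp: nat_less_iff)
      finally show ?thesis .
    qed
    then have "c (int k) = 0"
      by (rule periodic_spline_eq_0_imp[OF n _ _ z]) (simp add: c_def)
    then show ?thesis using k by (simp add: c_def)
  qed
  then show ?thesis by (simp add: complex_eq_iff)
qed

lemma gram_kernel_trivial:
  assumes n: "n \<ge> 1"
    and zero: "\<And>k. k < n \<Longrightarrow> ip unit_interval_measure (phi p n k) (\<lambda>t. \<Sum>j<n. a j * phi p n j t) = 0"
  shows "\<forall>k<n. a k = 0"
proof (rule phi_linear_independent[OF n])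
  interpret finite_measure unit_interval_measure by (rule finite_measure_restrict_lborel) auto
  let ?f = "\<lambda>t. \<Sum>k<n. a k * phi p n k t"
  have f: "?f \<in> bounded_measurable unit_interval_measure"
    by (intro bounded_measurable_intros phi_bounded_measurable) auto
  have "ip unit_interval_measure ?f ?f = (\<Sum>k<n. a k * ip unit_interval_measure (phi p n k) ?f)"
    using f by (intro ip_sum_left phi_bounded_measurable) auto
  then show "(LINT t|unit_interval_measure. (cmod (?f t))\<^sup>2) = 0"
    using zero by (simp add: ip_self)
qed

text \<open>A kernel vector of the Gram matrix would yield a combination orthogonal to the whole
  basis and hence to itself. So the kernel is trivial, and the inverse matrix supplies the dual
  coefficients.\<close>

lemma phi_dual_existence:
  assumes n: "n \<ge> 1"
  shows "\<exists>w. \<forall>k<n. \<forall>l<n. ip unit_interval_measure (phi p n k) (\<lambda>t. \<Sum>j<n. w l j * phi p n j t)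
    = (if k = l then 1 else 0)"
proof -
  interpret finite_measure unit_interval_measure by (rule finite_measure_restrict_lborel) auto
  define g where "g i j = ip unit_interval_measure (phi p n i) (phi p n j)" for i j
  define G where "G = Matrix.mat n n (\<lambda>(i, j). g i j)"
  have G: "G \<in> carrier_mat n n" by (simp add: G_def)
  have expand: "ip unit_interval_measure (phi p n k) (\<lambda>t. \<Sum>j<n. a j * phi p n j t)
      = (\<Sum>j<n. cnj (a j) * g k j)" if "k < n" for k a
    unfolding g_def using that by (intro ip_sum_right phi_bounded_measurable) auto
  have "Determinant.det G \<noteq> 0"
  proof
    assume "Determinant.det G = 0"
    then obtain v where v: "v \<in> carrier_vec n" "v \<noteq> 0\<^sub>v n" "G *\<^sub>v v = 0\<^sub>v n"
      using det_0_iff_vec_prod_zero_field[OF G] by blast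
    have "(\<Sum>j<n. vec_index v j * g k j) = 0" if k: "k < n" for k
    proof -
      have "(\<Sum>j<n. g k j * vec_index v j) = vec_index (G *\<^sub>v v) k"
        using k v(1) by (auto simp: G_def scalar_prod_def atLeast0LessThan)
      then show ?thesis using v k by (simp add: mult.commute)
    qed
    then have "\<forall>k<n. cnj (vec_index v k) = 0"
      by (intro gram_kernel_trivial[OF n, of p]) (simp add: expand)
    then have "v = 0\<^sub>v n" using v(1) by (intro eq_vecI) auto
    with v show False by simp
  qed
  then obtain W where W: "W \<in> carrier_mat n n" "G * W = 1\<^sub>m n"
    using det_non_zero_imp_unit[OF G] by (auto simp: Units_def ring_mat_def)
  \<comment> \<open>The conjugate compensates for the second argument of \<open>ip\<close> being
    conjugate-linear.\<close>
  have "ip unit_interval_measure (phi p n k) (\<lambda>t. \<Sum>j<n. cnj (W $$ (j, l)) * phi p n j t)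
      = (if k = l then 1 else 0)" if "k < n" "l < n" for k l
  proof -
    have "(G * W) $$ (k, l) = (\<Sum>j<n. W $$ (j, l) * g k j)"
      using that W(1) by (auto simp: G_def scalar_prod_def atLeast0LessThan mult.commute)
    then show ?thesis using that W by (simp add: expand)
  qed
  then show ?thesis by (intro exI[of _ "\<lambda>l j. cnj (W $$ (j, l))"]) blast
qed

text \<open>Uniqueness has to hold for functions on the whole line although the defining equations
  see only the unit interval; it is obtained by comparing coefficients.\<close>

lemma phi_dual_properties:
  assumes n: "n \<ge> 1" and l: "l < n"
  shows "phi_dual p n l \<in> spline_space p n"
    "k < n \<Longrightarrow> ip unit_interval_measure (phi p n k) (phi_dual p n l) = (if k = l then 1 else 0)"
proof -
  interpret finite_measure unit_interval_measure by (rule finite_measure_restrict_lborel) auto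
  let ?P = "\<lambda>\<psi>. \<psi> \<in> spline_space p n \<and>
    (\<forall>k<n. L2_inner {0<..<1} (phi p n k) \<psi> = (if k = l then 1 else 0))"
  have "\<exists>!\<psi>. ?P \<psi>"
  proof (rule ex_ex1I)
    obtain w where "\<forall>k<n. \<forall>l<n. ip unit_interval_measure (phi p n k) (\<lambda>t. \<Sum>j<n. w l j * phi p n j t)
        = (if k = l then 1 else 0)"
      using phi_dual_existence[OF n] by blast
    then show "\<exists>\<psi>. ?P \<psi>" using l
      by (intro exI[of _ "\<lambda>t. \<Sum>j<n. w l j * phi p n j t"])
         (auto simp: spline_space_def L2_inner_eq_ip)
  next
    fix \<psi> \<psi>' assume 1: "?P \<psi>" and 2: "?P \<psi>'"
    then obtain a b where ab: "\<psi> = (\<lambda>t. \<Sum>j<n. a j * phi p n j t)" "\<psi>' = (\<lambda>t. \<Sum>j<n. b j * phi p n j t)"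
      by (auto simp: spline_space_def)
    have \<psi>: "\<psi> \<in> bounded_measurable unit_interval_measure" "\<psi>' \<in> bounded_measurable unit_interval_measure"
      unfolding ab by (intro bounded_measurable_intros phi_bounded_measurable; simp)+
    have "\<forall>k<n. a k - b k = 0"
    proof (rule gram_kernel_trivial[OF n])
      fix k assume k: "k < n"
      have "(\<lambda>t. \<Sum>j<n. (a j - b j) * phi p n j t) = (\<lambda>t. \<psi> t - \<psi>' t)"
        by (simp add: ab left_diff_distrib sum_subtractf)
      moreover have "ip unit_interval_measure (phi p n k) (\<lambda>t. \<psi> t - \<psi>' t) = 0"
        using 1 2 k by (subst ip_diff_right[OF \<psi> phi_bounded_measurable]) (auto simp: L2_inner_eq_ip)
      ultimately show "ip unit_interval_measure (phi p n k) (\<lambda>t. \<Sum>j<n. (a j - b j) * phi p n j t) = 0"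
        by simp
    qed
    then show "\<psi> = \<psi>'" unfolding ab by (intro ext sum.cong) auto
  qed
  from theI'[OF this] have "?P (phi_dual p n l)" unfolding phi_dual_def .
  then show "phi_dual p n l \<in> spline_space p n"
    "k < n \<Longrightarrow> ip unit_interval_measure (phi p n k) (phi_dual p n l) = (if k = l then 1 else 0)"
    by (auto simp: L2_inner_eq_ip)
qed

section \<open>Tensor products: the continuous case\<close>

lemma multi_indices_eq_PiE: "multi_indices N = PiE UNIV (\<lambda>i. {..<N i})"
  by (auto simp: multi_indices_def PiE_UNIV_domain)

lemma finite_multi_indices: "finite (multi_indices N)"
  unfolding multi_indices_eq_PiE by (rule finite_PiE) auto

lemma sum_multi_indices_prod:
  fixes f :: "'d::finite \<Rightarrow> nat \<Rightarrow> 'a::comm_semiring_1"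
  shows "(\<Sum>k\<in>multi_indices N. \<Prod>i\<in>UNIV. f i (k i)) = (\<Prod>i\<in>UNIV. \<Sum>k<N i. f i k)"
  unfolding multi_indices_eq_PiE by (rule prod_sum_PiE[symmetric]) auto

lemma tensor_expansion:
  assumes "\<And>i k. k < N i \<Longrightarrow> \<psi> i k = (\<lambda>t. \<Sum>l<N i. c i k l * \<phi> i l t)" and "k \<in> multi_indices N"
  shows "tensor (\<lambda>i. \<psi> i (k i))
    = (\<lambda>t. \<Sum>l\<in>multi_indices N. (\<Prod>i\<in>UNIV. c i (k i) (l i)) * tensor (\<lambda>i. \<phi> i (l i)) t)"
proof
  fix t
  have "tensor (\<lambda>i. \<psi> i (k i)) t = (\<Prod>i\<in>UNIV. \<Sum>l<N i. c i (k i) l * \<phi> i l (t $ i))"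
    using assms by (simp add: tensor_def multi_indices_def)
  also have "\<dots> = (\<Sum>l\<in>multi_indices N. \<Prod>i\<in>UNIV. c i (k i) (l i) * \<phi> i (l i) (t $ i))"
    by (rule sum_multi_indices_prod[symmetric])
  finally show "tensor (\<lambda>i. \<psi> i (k i)) t
    = (\<Sum>l\<in>multi_indices N. (\<Prod>i\<in>UNIV. c i (k i) (l i)) * tensor (\<lambda>i. \<phi> i (l i)) t)"
    by (simp add: tensor_def prod.distrib)
qed

lemma prod_delta_multi_indices:
  fixes k l :: "'d::finite \<Rightarrow> nat"
  shows "(\<Prod>i\<in>UNIV. if k i = l i then 1 else 0 :: complex) = (if k = l then 1 else 0)"
proof (cases "k = l")
  case False
  then obtain i where "k i \<noteq> l i" by auto
  then show ?thesis using False by (auto intro!: prod_zero)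
qed simp

text \<open>Fubini for the product measure over \<open>Basis\<close>, of which Lebesgue measure is
  the image. Its factors are labelled by basis vectors, and \<open>idx\<close> recovers the
  coordinate \<open>i\<close> from \<open>axis i 1\<close>.\<close>

lemma integral_lborel_prod_vec:
  fixes g :: "'d::finite \<Rightarrow> real \<Rightarrow> 'b::{real_normed_field,banach,second_countable_topology}"
  assumes int: "\<And>i. integrable lborel (g i)"
  shows "(LINT t|lborel. (\<Prod>i\<in>UNIV. g i (t $ i))) = (\<Prod>i\<in>UNIV. (LINT x|lborel. g i x))"
proof -
  interpret product_sigma_finite "\<lambda>_ :: real^'d. lborel :: real measure" by standard
  have [measurable]: "g i \<in> borel_measurable borel" for i
    using borel_measurable_integrable[OF int[of i]] by simp
  define idx where "idx = inv_into UNIV (\<lambda>i :: 'd. axis i (1 :: real))"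
  have inj: "inj (\<lambda>i :: 'd. axis i (1 :: real))" by (auto simp: inj_on_def axis_eq_axis)
  have idx: "idx (axis i 1) = i" for i unfolding idx_def using inj by (rule inv_f_f)
  have Basis: "(Basis :: (real^'d) set) = range (\<lambda>i. axis i 1)"
    by (auto simp: Basis_vec_def)
  have reindex: "(\<Prod>b\<in>Basis. h b) = (\<Prod>i\<in>UNIV. h (axis i 1))" for h :: "real^'d \<Rightarrow> 'b"
    unfolding Basis using inj by (simp add: prod.reindex)
  have comp: "(\<Sum>b\<in>Basis. f b *\<^sub>R b) $ i = f (axis i 1)" for f :: "real^'d \<Rightarrow> real" and i
    using inner_sum_left_Basis[of "axis i (1 :: real)" f]
    by (simp add: cart_eq_inner_axis axis_in_Basis_iff)
  have "(LINT t|lborel. (\<Prod>i\<in>UNIV. g i (t $ i)))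
      = (LINT f|(\<Pi>\<^sub>M b\<in>Basis. lborel). (\<Prod>i\<in>UNIV. g i ((\<Sum>b\<in>Basis. f b *\<^sub>R b) $ i)))"
    by (subst lborel_eq, subst integral_distr) auto
  also have "\<dots> = (LINT f|(\<Pi>\<^sub>M b\<in>Basis. lborel). (\<Prod>b\<in>Basis. g (idx b) (f b)))"
    unfolding comp reindex idx ..
  also have "\<dots> = (\<Prod>b\<in>Basis. (LINT x|lborel. g (idx b) x))"
    using int by (intro product_integral_prod) auto
  finally show ?thesis unfolding reindex idx .
qed

lemma cbox_0_1_vec: "(cbox 0 1 :: (real^'d::finite) set) = {t. \<forall>i. t $ i \<in> {0..1}}"
  by (auto simp: mem_box_cart)

text \<open>The cube is closed while the univariate integrals run over the open interval; its two
  end points are null sets, so both sides have the same univariate factors.\<close>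

lemma integral_cbox_prod:
  fixes f :: "'d::finite \<Rightarrow> real \<Rightarrow> 'b::{real_normed_field,banach,second_countable_topology}"
  assumes [measurable]: "\<And>i. f i \<in> borel_measurable borel"
    and int: "\<And>i. integrable unit_interval_measure (f i)"
  shows "(LINT t|restrict_space lborel (cbox 0 1). (\<Prod>i\<in>UNIV. f i (t $ i)))
    = (\<Prod>i\<in>UNIV. (LINT x|unit_interval_measure. f i x))"
proof -
  define g where "g i x = indicator {0..1} x *\<^sub>R f i x" for i x
  have [measurable]: "g i \<in> borel_measurable borel" for i by (simp add: g_def[abs_def])
  have ae: "AE x in lborel. g i x = indicator {0<..<1} x *\<^sub>R f i x" for i
    using AE_lborel_singleton[of "0 :: real"] AE_lborel_singleton[of "1 :: real"]
    by eventually_elim (auto simp: g_def indicator_def)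
  have gi: "integrable lborel (g i)" for i
    using int[of i] integrable_cong_AE[OF _ _ ae[of i]] by (simp add: integrable_restrict_space)
  have gint: "(LINT x|lborel. g i x) = (LINT x|unit_interval_measure. f i x)" for i
    using integral_cong_AE[OF _ _ ae[of i]] by (simp add: integral_restrict_space)
  have "indicator (cbox 0 1) t *\<^sub>R (\<Prod>i\<in>UNIV. f i (t $ i)) = (\<Prod>i\<in>UNIV. g i (t $ i))" for t :: "real^'d"
  proof (cases "t \<in> cbox 0 1")
    case False
    then obtain i where "t $ i \<notin> {0..1}" unfolding cbox_0_1_vec by blast
    then have "g i (t $ i) = 0" by (simp add: g_def)
    then have "(\<Prod>i\<in>UNIV. g i (t $ i)) = 0" by (intro prod_zero) auto
    then show ?thesis using False by simp
  qed (simp add: g_def cbox_0_1_vec)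
  then have "(LINT t|restrict_space lborel (cbox 0 1). (\<Prod>i\<in>UNIV. f i (t $ i)))
      = (LINT t|lborel. (\<Prod>i\<in>UNIV. g i (t $ i)))"
    by (simp add: integral_restrict_space)
  also have "\<dots> = (\<Prod>i\<in>UNIV. (LINT x|lborel. g i x))"
    by (rule integral_lborel_prod_vec[OF gi])
  finally show ?thesis by (simp add: gint)
qed

lemma tensor_measurable:
  assumes "\<And>i. f i \<in> borel_measurable borel"
  shows "tensor f \<in> borel_measurable borel"
proof -
  have [measurable]: "f i \<in> borel_measurable borel" for i by (rule assms)
  show ?thesis unfolding tensor_def[abs_def] by measurable
qed

lemma ip_tensor:
  fixes f g :: "'d::finite \<Rightarrow> real \<Rightarrow> complex"
  assumes meas: "\<And>i. f i \<in> borel_measurable borel" "\<And>i. g i \<in> borel_measurable borel"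
    and bdd: "\<And>i. f i \<in> bounded_measurable unit_interval_measure"
      "\<And>i. g i \<in> bounded_measurable unit_interval_measure"
  shows "ip (restrict_space lborel (cbox 0 1)) (tensor f) (tensor g)
    = (\<Prod>i\<in>UNIV. ip unit_interval_measure (f i) (g i))"
proof -
  interpret finite_measure unit_interval_measure by (rule finite_measure_restrict_lborel) auto
  have [measurable]: "f i \<in> borel_measurable borel" "g i \<in> borel_measurable borel" for i
    by (rule meas)+
  have [measurable]: "cnj \<in> borel_measurable borel"
    by (intro borel_measurable_continuous_onI continuous_intros)
  have "ip (restrict_space lborel (cbox 0 1)) (tensor f) (tensor g)
      = (LINT t|restrict_space lborel (cbox 0 1). (\<Prod>i\<in>UNIV. f i (t $ i) * cnj (g i (t $ i))))"
    by (simp add: ip_def tensor_def prod.distrib)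
  also have "\<dots> = (\<Prod>i\<in>UNIV. (LINT x|unit_interval_measure. f i x * cnj (g i x)))"
    using integral_cbox_prod[of "\<lambda>i x. f i x * cnj (g i x)"] integrable_ip[OF bdd] by simp
  finally show ?thesis by (simp add: ip_def)
qed

text \<open>The sup bound and the L1 norm are reciprocal, which is the normalisation that
  \<open>bessel_partition\<close> asks for and which also bounds the L2 norm by 1.\<close>

lemma tensor_phi_facts:
  fixes p N k :: "'d::finite \<Rightarrow> nat"
  assumes k: "k \<in> multi_indices N"
  shows "Phi p N k \<in> borel_measurable borel"
    and "cmod (Phi p N k t) \<le> (\<Prod>i\<in>UNIV. sqrt (real (N i)))"
    and "(LINT t|restrict_space lborel (cbox 0 1). cmod (Phi p N k t)) = 1 / (\<Prod>i\<in>UNIV. sqrt (real (N i)))"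
proof -
  have lt: "k i < N i" for i using k by (simp add: multi_indices_def)
  have [measurable]: "phi (p i) (N i) (k i) \<in> borel_measurable borel" for i
    using lt by (rule phi_measurable)
  show "Phi p N k \<in> borel_measurable borel"
    unfolding Phi_def by (rule tensor_measurable) simp
  show "cmod (Phi p N k t) \<le> (\<Prod>i\<in>UNIV. sqrt (real (N i)))"
    unfolding Phi_def tensor_def prod_norm[symmetric] using lt by (intro prod_mono) (simp add: norm_phi_le)
  interpret finite_measure unit_interval_measure by (rule finite_measure_restrict_lborel) auto
  have "(LINT t|restrict_space lborel (cbox 0 1). cmod (Phi p N k t))
      = (LINT t|restrict_space lborel (cbox 0 1). (\<Prod>i\<in>UNIV. cmod (phi (p i) (N i) (k i) (t $ i))))"
    by (simp add: Phi_def tensor_def prod_norm)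
  also have "\<dots> = (\<Prod>i\<in>UNIV. (LINT x|unit_interval_measure. cmod (phi (p i) (N i) (k i) x)))"
    using lt by (intro integral_cbox_prod integrable_norm integrable_bounded_measurable
        phi_bounded_measurable) auto
  also have "\<dots> = (\<Prod>i\<in>UNIV. 1 / sqrt (real (N i)))"
    using lt integral_norm_phi by (simp add: integral_restrict_space)
  finally show "(LINT t|restrict_space lborel (cbox 0 1). cmod (Phi p N k t))
      = 1 / (\<Prod>i\<in>UNIV. sqrt (real (N i)))"
    by (simp add: prod_dividef)
qed

lemma Phi_bounded_measurable:
  "k \<in> multi_indices N \<Longrightarrow> Phi p N k \<in> bounded_measurable (restrict_space lborel (cbox 0 1))"
  using tensor_phi_facts[of k N p]
  by (intro bounded_measurableI[where B = "\<Prod>i\<in>UNIV. sqrt (real (N i))"])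
     (auto intro: measurable_restrict_space1)

lemma sum_norm_Phi:
  assumes "\<And>i. N i \<ge> 1"
  shows "(\<Sum>k\<in>multi_indices N. cmod (Phi p N k t)) = (\<Prod>i\<in>UNIV. sqrt (real (N i)))"
  unfolding Phi_def tensor_def prod_norm[symmetric]
  by (subst sum_multi_indices_prod) (intro prod.cong refl sum_norm_phi assms)

lemma phi_dual_coefficients:
  assumes "n \<ge> 1"
  shows "\<exists>c. \<forall>l<n. phi_dual p n l = (\<lambda>t. \<Sum>k<n. c l k * phi p n k t)"
proof -
  have "\<forall>l. \<exists>c. l < n \<longrightarrow> phi_dual p n l = (\<lambda>t. \<Sum>k<n. c k * phi p n k t)"
    using phi_dual_properties(1)[OF assms] by (auto simp: spline_space_def)
  then show ?thesis by metis
qed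

lemma Phi_biorthogonal_system:
  fixes p N :: "'d::finite \<Rightarrow> nat"
  assumes N: "\<And>i. N i \<ge> 1"
  shows "\<exists>c. biorthogonal_system (restrict_space lborel (cbox 0 1)) (multi_indices N) (Phi p N) (Phi_dual p N) c"
proof -
  have "\<forall>i. \<exists>c. \<forall>l<N i. phi_dual (p i) (N i) l = (\<lambda>t. \<Sum>k<N i. c l k * phi (p i) (N i) k t)"
    using phi_dual_coefficients[OF N] by blast
  then obtain c where c: "\<And>i l. l < N i \<Longrightarrow>
      phi_dual (p i) (N i) l = (\<lambda>t. \<Sum>k<N i. c i l k * phi (p i) (N i) k t)"
    by metis
  have dual_meas: "phi_dual (p i) (N i) l \<in> borel_measurable borel" if "l < N i" for i l
    unfolding c[OF that] by (intro borel_measurable_sum borel_measurable_times phi_measurable) auto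
  have dual_bdd: "phi_dual (p i) (N i) l \<in> bounded_measurable unit_interval_measure" if "l < N i" for i l
    unfolding c[OF that] by (intro bounded_measurable_intros phi_bounded_measurable) auto
  have "biorthogonal_system (restrict_space lborel (cbox 0 1)) (multi_indices N) (Phi p N) (Phi_dual p N)
      (\<lambda>k l. \<Prod>i\<in>UNIV. c i (k i) (l i))"
  proof (intro biorthogonal_system.intro biorthogonal_system_axioms.intro)
    show "finite_measure (restrict_space lborel (cbox 0 1 :: (real^'d) set))"
      by (rule finite_measure_restrict_lborel) auto
    show "Phi_dual p N k = (\<lambda>x. \<Sum>l\<in>multi_indices N. (\<Prod>i\<in>UNIV. c i (k i) (l i)) * Phi p N l x)"
      if "k \<in> multi_indices N" for k
      unfolding Phi_dual_def Phi_def using c that by (rule tensor_expansion)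
    show "ip (restrict_space lborel (cbox 0 1)) (Phi p N k) (Phi_dual p N l) = (if k = l then 1 else 0)"
      if "k \<in> multi_indices N" "l \<in> multi_indices N" for k l
    proof -
      have lt: "k i < N i" "l i < N i" for i using that by (auto simp: multi_indices_def)
      have "ip (restrict_space lborel (cbox 0 1)) (Phi p N k) (Phi_dual p N l)
          = (\<Prod>i\<in>UNIV. ip unit_interval_measure (phi (p i) (N i) (k i)) (phi_dual (p i) (N i) (l i)))"
        unfolding Phi_def Phi_dual_def using lt
        by (intro ip_tensor phi_measurable dual_meas phi_bounded_measurable dual_bdd) auto
      also have "\<dots> = (\<Prod>i\<in>UNIV. if k i = l i then 1 else 0)"
        using lt N by (intro prod.cong refl phi_dual_properties(2)) auto
      finally show ?thesis by (simp only: prod_delta_multi_indices)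
    qed
  qed (auto intro: finite_multi_indices Phi_bounded_measurable)
  then show ?thesis by blast
qed

section \<open>The residual matrix in the continuous case\<close>

lemma indexed_mat_cong:
  assumes "enumerates xs S" "enumerates ys T" "\<And>x y. x \<in> S \<Longrightarrow> y \<in> T \<Longrightarrow> f x y = g x y"
  shows "indexed_mat xs ys f = indexed_mat xs ys g"
  using assms by (auto simp: indexed_mat_def enumerates_def intro!: eq_matI)

lemma supp_disjoint_iff:
  assumes "t \<in> cbox 0 1" "t \<in> A" "supp f \<inter> A = {}"
  shows "f t = 0"
  using assms closure_subset[of "{t \<in> cbox 0 1. f t \<noteq> 0}"] by (auto simp: supp_def)

lemma continuous_residual_bounds:
  fixes \<Omega> :: "(real^'d::finite) set" and p N :: "'d \<Rightarrow> nat"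
  assumes \<Omega>: "compact \<Omega>" "\<Omega> \<subseteq> cbox 0 1" and \<delta>: "\<delta> > 0"
    and N: "\<And>i. N i \<ge> 1" and ks: "enumerates ks (multi_indices N)"
  defines "R \<equiv> AZ_residual (A_cont p \<Omega> N ks) (Z_cont p N ks)"
    and "K \<equiv> boundary_indices p \<Omega> N"
  shows "card (nonzero_cols R) \<le> card K" "mat_rank R \<le> card K"
    "real (card (large_rows \<delta> R)) \<le> 1 / \<delta>\<^sup>2 * real (card K)"
    "real (card (large_entries \<delta> R)) \<le> 1 / \<delta>\<^sup>2 * real (card K)"
proof -
  let ?M = "restrict_space lborel (cbox 0 1) :: (real^'d) measure"
  let ?I = "multi_indices N"
  obtain c where "biorthogonal_system ?M ?I (Phi p N) (Phi_dual p N) c"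
    using Phi_biorthogonal_system[of N p, OF N] by blast
  then interpret biorthogonal_system ?M ?I "Phi p N" "Phi_dual p N" c .
  have space: "space ?M = cbox 0 1" by (simp add: space_restrict_space)
  have \<Omega>_borel: "\<Omega> \<in> sets borel" using \<Omega>(1) by (simp add: borel_compact)
  then have \<Omega>_sets: "\<Omega> \<in> sets ?M" using \<Omega>(2) by (auto simp: sets_restrict_space_iff)
  define w where "w = (\<Prod>i\<in>UNIV. sqrt (real (N i)))"
  have w: "w > 0" unfolding w_def using N by (intro prod_pos) (auto simp: Suc_le_eq)
  have A: "L2_inner \<Omega> (Phi p N k) (Phi p N l) = ip ?M (Phi p N k) (restricted \<Omega> l)" for k l
    unfolding L2_inner_def ip_def set_lebesgue_integral_def
    using \<Omega>(2) by (subst integral_restrict_space)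
      (auto simp: restricted_def indicator_def intro!: Bochner_Integration.integral_cong)
  have Z: "L2_inner (cbox 0 1) (Phi_dual p N k) (Phi_dual p N l) = c k l" if "k \<in> ?I" "l \<in> ?I" for k l
    using that by (simp add: L2_inner_eq_ip dual_coefficient)
  have "A_cont p \<Omega> N ks = indexed_mat ks ks (\<lambda>k l. ip ?M (Phi p N k) (restricted \<Omega> l))"
    by (simp add: A_cont_def A)
  moreover have "Z_cont p N ks = indexed_mat ks ks c"
    unfolding Z_cont_def by (intro indexed_mat_cong[OF ks ks] Z)
  ultimately have R: "R = indexed_mat ks ks (\<lambda>i j. ip ?M (Phi p N i) (residual \<Omega> j))"
    unfolding R_def by (simp add: AZ_residual_indexed_mat[OF ks ks])
      (intro indexed_mat_cong[OF ks ks], simp add: residual_eq_gram[OF \<Omega>_sets])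
  have K: "finite K"
    by (rule finite_subset[OF _ finite_multi_indices[of N]]) (auto simp: K_def boundary_indices_def)
  have zero: "ip ?M (Phi p N i) (residual \<Omega> j) = 0" if "i \<in> ?I" "j \<in> ?I - K" for i j
  proof -
    have "supp (Phi p N j) \<inter> \<Omega> = {} \<or> supp (Phi p N j) \<inter> (cbox 0 1 - \<Omega>) = {}"
      using that by (auto simp: K_def boundary_indices_def)
    then have "(\<forall>x\<in>space ?M \<inter> \<Omega>. Phi p N j x = 0) \<or> (\<forall>x\<in>space ?M - \<Omega>. Phi p N j x = 0)"
      unfolding space using supp_disjoint_iff[of _ _ "Phi p N j"] by blast
    then have "residual \<Omega> j x = 0" if "x \<in> space ?M" for x
      using that \<open>j \<in> ?I - K\<close> by (intro residual_eq_0) auto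
    then have "ip ?M (Phi p N i) (residual \<Omega> j) = ip ?M (Phi p N i) (\<lambda>x. 0)"
      unfolding ip_def by (intro Bochner_Integration.integral_cong) auto
    then show ?thesis by (simp add: ip_def)
  qed
  have bound: "(\<Sum>i\<in>?I. (cmod (ip ?M (Phi p N i) (residual \<Omega> j)))\<^sup>2) \<le> 1" if j: "j \<in> ?I" for j
  proof -
    have "(\<Sum>i\<in>?I. (cmod (ip ?M (Phi p N i) (residual \<Omega> j)))\<^sup>2) \<le> (LINT x|?M. (cmod (residual \<Omega> j x))\<^sup>2)"
      by (rule bessel_partition[where w = w])
         (use j w \<Omega>_sets in \<open>auto simp: sum_norm_Phi[of N, OF N, folded w_def] tensor_phi_facts(3)[of _ N, folded w_def]
           intro: finite_multi_indices Phi_bounded_measurable residual_bounded\<close>)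
    also have "\<dots> \<le> (LINT x|?M. (cmod (Phi p N j x))\<^sup>2)"
      by (rule norm_residual_le[OF \<Omega>_sets j])
    \<comment> \<open>One factor of the square is replaced by its sup bound \<open>w\<close>; the
      remaining L1 norm is \<open>1 / w\<close>.\<close>
    also have "\<dots> \<le> (LINT x|?M. w * cmod (Phi p N j x))"
      using j tensor_phi_facts(2)[OF j, of p]
      by (intro integral_mono integrable_norm_square integrable_mult_right integrable_norm
          integrable_bounded_measurable Phi_bounded_measurable)
         (auto simp: power2_eq_square w_def intro!: mult_right_mono)
    also have "\<dots> = 1"
      using tensor_phi_facts(3)[OF j, of p, folded w_def] w by simp
    finally show ?thesis .
  qed
  show "card (nonzero_cols R) \<le> card K" "mat_rank R \<le> card K"
    "real (card (large_rows \<delta> R)) \<le> 1 / \<delta>\<^sup>2 * real (card K)"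
    "real (card (large_entries \<delta> R)) \<le> 1 / \<delta>\<^sup>2 * real (card K)"
    unfolding R using indexed_mat_bounds[OF ks ks K \<delta> zero_le_one,
        where r = "\<lambda>i j. ip ?M (Phi p N i) (residual \<Omega> j)", OF zero bound] by blast+
qed

section \<open>Tensor products: the discrete case\<close>

lemma phi_discrete_eq_cyclic:
  "k < n \<Longrightarrow> phi_discrete p n k t = complex_of_real (cyclic_bspline p n k (real n * t))"
  by (simp add: phi_discrete_def phi_eq_cyclic)

lemma norm_phi_discrete:
  "k < n \<Longrightarrow> cmod (phi_discrete p n k t) = cyclic_bspline p n k (real n * t)"
  by (simp add: phi_discrete_eq_cyclic cyclic_bspline_nonneg)

text \<open>Writing \<open>m = j * q + r\<close> splits the scaled grid into \<open>q\<close>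
  shifted copies of the integers below \<open>n\<close>, and each copy contributes 1 by the
  partition of unity over translates.\<close>

lemma sum_norm_phi_discrete:
  assumes k: "k < n" and q: "q \<ge> 1"
  shows "(\<Sum>m<n * q. cmod (phi_discrete p n k (real m / (real q * real n)))) = real q"
proof -
  let ?f = "\<lambda>m. cyclic_bspline p n k (real m / real q)"
  have "(\<Sum>m<n * q. cmod (phi_discrete p n k (real m / (real q * real n)))) = (\<Sum>m<n * q. ?f m)"
    using k by (simp add: norm_phi_discrete)
  also have "\<dots> = (\<Sum>j<n. \<Sum>m\<in>{j * q..<j * q + q}. ?f m)"
    by (rule sum.nat_group[symmetric])
  also have "\<dots> = (\<Sum>j<n. \<Sum>r<q. ?f (j * q + r))"
    using sum.shift_bounds_nat_ivl[of ?f 0 "j * q" q for j]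
    by (simp add: add.commute atLeast0LessThan)
  also have "\<dots> = (\<Sum>j<n. \<Sum>r<q. cyclic_bspline p n k (real r / real q + real j))"
    using q by (intro sum.cong refl arg_cong[where f = "cyclic_bspline p n k"]) (simp add: field_simps)
  also have "\<dots> = (\<Sum>r<q. \<Sum>j<n. cyclic_bspline p n k (real r / real q + real j))"
    by (rule sum.swap)
  also have "\<dots> = real q"
    using k by (simp add: sum_cyclic_bspline_translates)
  finally show ?thesis .
qed

lemma phi_discrete_dual_properties:
  assumes "discrete_dual_exists p q" "n \<ge> 1" "l < n"
  shows "is_discrete_dual p q n l (phi_discrete_dual p q n l)"
proof -
  have "\<exists>!\<psi>. is_discrete_dual p q n l \<psi>"
    using assms by (simp add: discrete_dual_exists_def)
  then show ?thesis unfolding phi_discrete_dual_def by (rule theI')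
qed

lemma phi_discrete_dual_coefficients:
  assumes "discrete_dual_exists p q" "n \<ge> 1"
  shows "\<exists>c. \<forall>l<n. phi_discrete_dual p q n l = (\<lambda>t. \<Sum>k<n. c l k * phi_discrete p n k t)"
proof -
  have "\<exists>c. phi_discrete_dual p q n l = (\<lambda>t. \<Sum>k<n. c k * phi_discrete p n k t)" if "l < n" for l
  proof -
    have "phi_discrete_dual p q n l \<in> spline_space p n"
      using phi_discrete_dual_properties[OF assms that] by (simp add: is_discrete_dual_def)
    then obtain c where "phi_discrete_dual p q n l = (\<lambda>t. \<Sum>k<n. c k * phi p n k t)"
      by (auto simp: spline_space_def)
    also have "\<dots> = (\<lambda>t. \<Sum>k<n. (c k * complex_of_real (sqrt (real n))) * phi_discrete p n k t)"
      using assms(2) by (simp add: phi_discrete_def)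
    finally show ?thesis by (rule exI[where x = "\<lambda>k. c k * complex_of_real (sqrt (real n))"])
  qed
  then show ?thesis by metis
qed

section \<open>The multivariate grid and the residual matrix in the discrete case\<close>

lemma grid_eq_image:
  "grid q N = (\<lambda>k. \<chi> i. real (k i) / (real (q i) * real (N i))) ` multi_indices (\<lambda>i. N i * q i)"
  unfolding grid_def multi_indices_def by blast

lemma finite_grid: "finite (grid q N)"
  unfolding grid_eq_image by (intro finite_imageI finite_multi_indices)

lemma grid_subset_cbox:
  assumes N: "\<And>i. N i \<ge> 1" and q: "\<And>i. q i \<ge> 1"
  shows "grid q N \<subseteq> cbox 0 1"
proof
  fix t assume "t \<in> grid q N"
  then obtain k where t: "t = (\<chi> i. real (k i) / (real (q i) * real (N i)))" and k: "\<And>i. k i < N i * q i"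
    by (auto simp: grid_def)
  have "real (k i) / (real (q i) * real (N i)) \<le> 1" for i
  proof -
    have "real (k i) \<le> real (N i * q i)" using k[of i] by linarith
    moreover have "0 < real (q i) * real (N i)" using N[of i] q[of i] by simp
    ultimately show ?thesis by (simp add: divide_le_eq_1 mult.commute)
  qed
  then show "t \<in> cbox 0 1" unfolding t by (simp add: mem_box_cart)
qed

lemma sum_grid_prod:
  fixes f :: "'d::finite \<Rightarrow> real \<Rightarrow> 'a::comm_semiring_1"
  assumes N: "\<And>i. N i \<ge> 1" and q: "\<And>i. q i \<ge> 1"
  shows "(\<Sum>t\<in>grid q N. \<Prod>i\<in>UNIV. f i (t $ i))
    = (\<Prod>i\<in>UNIV. \<Sum>m<N i * q i. f i (real m / (real (q i) * real (N i))))"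
proof -
  have "inj_on (\<lambda>k. \<chi> i. real (k i) / (real (q i) * real (N i))) (multi_indices (\<lambda>i. N i * q i))"
  proof (rule inj_onI)
    fix k l :: "'d \<Rightarrow> nat"
    assume eq: "(\<chi> i. real (k i) / (real (q i) * real (N i))) = (\<chi> i. real (l i) / (real (q i) * real (N i)))"
    show "k = l"
    proof
      fix i
      have "real (k i) / (real (q i) * real (N i)) = real (l i) / (real (q i) * real (N i))"
        using arg_cong[OF eq, of "\<lambda>v. v $ i"] unfolding vec_lambda_beta .
      then show "k i = l i" using N[of i] q[of i] by simp
    qed
  qed
  then have "(\<Sum>t\<in>grid q N. \<Prod>i\<in>UNIV. f i (t $ i))
      = (\<Sum>k\<in>multi_indices (\<lambda>i. N i * q i). \<Prod>i\<in>UNIV. f i (real (k i) / (real (q i) * real (N i))))"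
    unfolding grid_eq_image by (simp add: sum.reindex)
  also have "\<dots> = (\<Prod>i\<in>UNIV. \<Sum>m<N i * q i. f i (real m / (real (q i) * real (N i))))"
    by (rule sum_multi_indices_prod)
  finally show ?thesis .
qed

lemma ip_count_space: "finite A \<Longrightarrow> ip (count_space A) f g = (\<Sum>t\<in>A. f t * cnj (g t))"
  by (simp add: ip_def lebesgue_integral_count_space_finite)

lemma bounded_measurable_count_space:
  assumes "finite A"
  shows "f \<in> bounded_measurable (count_space A)"
  by (rule bounded_measurableI[where B = "\<Sum>x\<in>A. cmod (f x)"]) (use assms in \<open>auto intro!: member_le_sum\<close>)

text \<open>The sum over the grid factors into univariate discrete inner products; their
  biorthogonality comes from \<open>discrete_dual_exists\<close>, which takes the place of the Gram
  matrix argument on the interval.\<close>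

lemma Phi_discrete_biorthogonal_system:
  fixes p q N :: "'d::finite \<Rightarrow> nat"
  assumes N: "\<And>i. N i \<ge> 1" and q: "\<And>i. q i \<ge> 1" and ex: "\<And>i. discrete_dual_exists (p i) (q i)"
  shows "\<exists>c. biorthogonal_system (count_space (grid q N)) (multi_indices N)
    (Phi_discrete p N) (Phi_discrete_dual p q N) c"
proof -
  have "\<forall>i. \<exists>c. \<forall>l<N i. phi_discrete_dual (p i) (q i) (N i) l
      = (\<lambda>t. \<Sum>k<N i. c l k * phi_discrete (p i) (N i) k t)"
    using phi_discrete_dual_coefficients[OF ex N] by blast
  then obtain c where c: "\<And>i l. l < N i \<Longrightarrow> phi_discrete_dual (p i) (q i) (N i) l
      = (\<lambda>t. \<Sum>k<N i. c i l k * phi_discrete (p i) (N i) k t)"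
    by metis
  have "biorthogonal_system (count_space (grid q N)) (multi_indices N)
    (Phi_discrete p N) (Phi_discrete_dual p q N) (\<lambda>k l. \<Prod>i\<in>UNIV. c i (k i) (l i))"
  proof (intro biorthogonal_system.intro biorthogonal_system_axioms.intro)
    show "finite_measure (count_space (grid q N))"
      by (rule finite_measure_count_space[OF finite_grid])
    show "Phi_discrete_dual p q N k
        = (\<lambda>x. \<Sum>l\<in>multi_indices N. (\<Prod>i\<in>UNIV. c i (k i) (l i)) * Phi_discrete p N l x)"
      if "k \<in> multi_indices N" for k
      unfolding Phi_discrete_dual_def Phi_discrete_def using c that by (rule tensor_expansion)
    show "ip (count_space (grid q N)) (Phi_discrete p N k) (Phi_discrete_dual p q N l)
        = (if k = l then 1 else 0)"
      if "k \<in> multi_indices N" "l \<in> multi_indices N" for k l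
    proof -
      let ?f = "\<lambda>i. phi_discrete (p i) (N i) (k i)" and ?g = "\<lambda>i. phi_discrete_dual (p i) (q i) (N i) (l i)"
      have lt: "k i < N i" "l i < N i" for i using that by (auto simp: multi_indices_def)
      have "ip (count_space (grid q N)) (Phi_discrete p N k) (Phi_discrete_dual p q N l)
          = (\<Sum>t\<in>grid q N. \<Prod>i\<in>UNIV. ?f i (t $ i) * cnj (?g i (t $ i)))"
        by (simp add: ip_count_space finite_grid Phi_discrete_def Phi_discrete_dual_def tensor_def prod.distrib)
      also have "\<dots> = (\<Prod>i\<in>UNIV. discrete_inner (N i) (q i) (?f i) (?g i))"
        unfolding discrete_inner_def by (rule sum_grid_prod[OF N q])
      also have "\<dots> = (\<Prod>i\<in>UNIV. if k i = l i then 1 else 0)"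
        using phi_discrete_dual_properties[OF ex N lt(2)] lt(1)
        by (intro prod.cong refl) (simp add: is_discrete_dual_def)
      finally show ?thesis by (simp only: prod_delta_multi_indices)
    qed
  qed (auto intro: finite_multi_indices bounded_measurable_count_space finite_grid)
  then show ?thesis by blast
qed

text \<open>The moduli are at most 1, so squaring only decreases them, and the sum of the moduli
  factors into the univariate grid sums \<open>q i\<close>.\<close>

lemma sum_norm_Phi_discrete_square_le:
  fixes p q N :: "'d::finite \<Rightarrow> nat"
  assumes N: "\<And>i. N i \<ge> 1" and q: "\<And>i. q i \<ge> 1" and k: "k \<in> multi_indices N"
  shows "(\<Sum>t\<in>grid q N. (cmod (Phi_discrete p N k t))\<^sup>2) \<le> (\<Prod>i\<in>UNIV. real (q i))"
proof -
  have lt: "k i < N i" for i using k by (simp add: multi_indices_def)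
  have norm: "cmod (Phi_discrete p N k t) = (\<Prod>i\<in>UNIV. cmod (phi_discrete (p i) (N i) (k i) (t $ i)))" for t
    by (simp add: Phi_discrete_def tensor_def prod_norm)
  have "cmod (Phi_discrete p N k t) \<le> 1" for t
    unfolding norm using lt by (intro prod_le_1) (simp add: norm_phi_discrete cyclic_bspline_nonneg cyclic_bspline_le_1)
  then have "(cmod (Phi_discrete p N k t))\<^sup>2 \<le> cmod (Phi_discrete p N k t)" for t
    by (simp add: power2_eq_square mult_left_le)
  then have "(\<Sum>t\<in>grid q N. (cmod (Phi_discrete p N k t))\<^sup>2) \<le> (\<Sum>t\<in>grid q N. cmod (Phi_discrete p N k t))"
    by (intro sum_mono)
  also have "\<dots> = (\<Prod>i\<in>UNIV. \<Sum>m<N i * q i. cmod (phi_discrete (p i) (N i) (k i) (real m / (real (q i) * real (N i)))))"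
    unfolding norm by (rule sum_grid_prod[OF N q])
  also have "\<dots> = (\<Prod>i\<in>UNIV. real (q i))"
    using lt q by (intro prod.cong refl sum_norm_phi_discrete)
  finally show ?thesis .
qed

lemma discrete_residual_bounds:
  fixes \<Omega> :: "(real^'d::finite) set" and p q N :: "'d \<Rightarrow> nat"
  assumes \<delta>: "\<delta> > 0" and N: "\<And>i. N i \<ge> 1" and q: "\<And>i. q i \<ge> 1"
    and ex: "\<And>i. discrete_dual_exists (p i) (q i)"
    and ts: "enumerates ts (grid q N \<inter> \<Omega>)" and ks: "enumerates ks (multi_indices N)"
  defines "R \<equiv> AZ_residual (A_disc p N ts ks) (Z_disc p q N ts ks)"
    and "K \<equiv> discrete_boundary_indices p q \<Omega> N"
    and "C \<equiv> \<Prod>i\<in>UNIV. real (q i)"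
  shows "card (nonzero_cols R) \<le> card K" "mat_rank R \<le> card K"
    "real (card (large_rows \<delta> R)) \<le> C / \<delta>\<^sup>2 * real (card K)"
    "real (card (large_entries \<delta> R)) \<le> C / \<delta>\<^sup>2 * real (card K)"
proof -
  let ?M = "count_space (grid q N)" and ?I = "multi_indices N" and ?\<Omega> = "grid q N \<inter> \<Omega>"
  obtain c where "biorthogonal_system ?M ?I (Phi_discrete p N) (Phi_discrete_dual p q N) c"
    using Phi_discrete_biorthogonal_system[of N q p, OF N q ex] by blast
  then interpret biorthogonal_system ?M ?I "Phi_discrete p N" "Phi_discrete_dual p q N" c .
  have \<Omega>_sets: "?\<Omega> \<in> sets ?M" by simp
  have inner: "ip ?M (restricted ?\<Omega> j) (Phi_discrete_dual p q N k)
      = (\<Sum>m\<in>?\<Omega>. cnj (Phi_discrete_dual p q N k m) * Phi_discrete p N j m)" for j k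
    unfolding ip_count_space[OF finite_grid]
    by (rule sum.mono_neutral_cong_right) (auto simp: finite_grid restricted_def indicator_def mult.commute)
  have R: "R = indexed_mat ts ks (\<lambda>t j. residual ?\<Omega> j t)"
    unfolding R_def A_disc_def Z_disc_def AZ_residual_indexed_mat[OF ts ks]
    by (intro indexed_mat_cong[OF ts ks]) (simp add: residual_eq_sampled inner)
  have K: "finite K"
    by (rule finite_subset[OF _ finite_multi_indices[of N]]) (auto simp: K_def discrete_boundary_indices_def)
  have zero: "residual ?\<Omega> j t = 0" if "t \<in> ?\<Omega>" "j \<in> ?I - K" for t j
  proof (rule residual_eq_0)
    \<comment> \<open>\<open>supp\<close> registers non-zero values only inside the cube, so
      disjointness from the support says something about every grid point only because the grid lies
      there.\<close>
    have cbox: "grid q N \<subseteq> cbox 0 1" by (rule grid_subset_cbox[of N q, OF N q])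
    have "supp (Phi_discrete p N j) \<inter> (grid q N \<inter> \<Omega>) = {}
        \<or> supp (Phi_discrete p N j) \<inter> (grid q N \<inter> (cbox 0 1 - \<Omega>)) = {}"
      using that by (auto simp: K_def discrete_boundary_indices_def discrete_supp_def)
    then show "(\<forall>x\<in>space ?M \<inter> ?\<Omega>. Phi_discrete p N j x = 0) \<or> (\<forall>x\<in>space ?M - ?\<Omega>. Phi_discrete p N j x = 0)"
      using supp_disjoint_iff[of _ _ "Phi_discrete p N j"] cbox by (auto; blast)
  qed (use that in auto)
  have bound: "(\<Sum>t\<in>?\<Omega>. (cmod (residual ?\<Omega> j t))\<^sup>2) \<le> C" if j: "j \<in> ?I" for j
  proof -
    have "(\<Sum>t\<in>?\<Omega>. (cmod (residual ?\<Omega> j t))\<^sup>2) \<le> (\<Sum>t\<in>grid q N. (cmod (residual ?\<Omega> j t))\<^sup>2)"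
      by (intro sum_mono2 finite_grid) auto
    also have "\<dots> \<le> (\<Sum>t\<in>grid q N. (cmod (Phi_discrete p N j t))\<^sup>2)"
      using norm_residual_le[OF \<Omega>_sets j] by (simp add: lebesgue_integral_count_space_finite finite_grid)
    also have "\<dots> \<le> C"
      unfolding C_def by (rule sum_norm_Phi_discrete_square_le[OF N q j])
    finally show ?thesis .
  qed
  have "0 \<le> C" unfolding C_def by (intro prod_nonneg) auto
  then show "card (nonzero_cols R) \<le> card K" "mat_rank R \<le> card K"
    "real (card (large_rows \<delta> R)) \<le> C / \<delta>\<^sup>2 * real (card K)"
    "real (card (large_entries \<delta> R)) \<le> C / \<delta>\<^sup>2 * real (card K)"
    unfolding R using indexed_mat_bounds[OF ts ks K \<delta>,
        where r = "\<lambda>t j. residual ?\<Omega> j t", OF _ zero bound] by blast+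
qed

theorem theorem3:
  fixes \<Omega> :: "(real^'d) set" and \<delta> :: real and p q :: "'d::finite \<Rightarrow> nat"
  assumes "compact \<Omega>" and "\<Omega> \<subseteq> cbox 0 1" and "\<delta> > 0"
  shows
    "(let R = (\<lambda>N ks. AZ_residual (A_cont p \<Omega> N ks) (Z_cont p N ks));
          K = boundary_indices p \<Omega>;
          valid = (\<lambda>N ks. (\<forall>i. N i \<ge> 1) \<and> enumerates ks (multi_indices N))
      in (\<forall>N ks. valid N ks \<longrightarrow> card (nonzero_cols (R N ks)) \<le> card (K N)) \<and>
         (\<forall>N ks. valid N ks \<longrightarrow> mat_rank (R N ks) \<le> card (K N)) \<and>
         (\<exists>C::real. \<forall>N ks. valid N ks \<longrightarrow>
            real (card (large_rows \<delta> (R N ks))) \<le> C * real (card (K N))) \<and>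
         (\<exists>C::real. \<forall>N ks. valid N ks \<longrightarrow>
            real (card (large_entries \<delta> (R N ks))) \<le> C * real (card (K N)))) \<and>
     ((\<forall>i. q i \<ge> 1 \<and> discrete_dual_exists (p i) (q i)) \<longrightarrow>
      (let R = (\<lambda>N ts ks. AZ_residual (A_disc p N ts ks) (Z_disc p q N ts ks));
           K = discrete_boundary_indices p q \<Omega>;
           valid = (\<lambda>N ts ks. (\<forall>i. N i \<ge> 1) \<and> enumerates ts (grid q N \<inter> \<Omega>)
                               \<and> enumerates ks (multi_indices N))
       in (\<forall>N ts ks. valid N ts ks \<longrightarrow> card (nonzero_cols (R N ts ks)) \<le> card (K N)) \<and>
          (\<forall>N ts ks. valid N ts ks \<longrightarrow> mat_rank (R N ts ks) \<le> card (K N)) \<and>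
          (\<exists>C::real. \<forall>N ts ks. valid N ts ks \<longrightarrow>
             real (card (large_rows \<delta> (R N ts ks))) \<le> C * real (card (K N))) \<and>
          (\<exists>C::real. \<forall>N ts ks. valid N ts ks \<longrightarrow>
             real (card (large_entries \<delta> (R N ts ks))) \<le> C * real (card (K N)))))"
  unfolding Let_def
proof (intro conjI impI)
  note cont = continuous_residual_bounds[OF assms]
  show "\<forall>N ks. (\<forall>i. N i \<ge> 1) \<and> enumerates ks (multi_indices N) \<longrightarrow>
      card (nonzero_cols (AZ_residual (A_cont p \<Omega> N ks) (Z_cont p N ks))) \<le> card (boundary_indices p \<Omega> N)"
    using cont(1) by blast
  show "\<forall>N ks. (\<forall>i. N i \<ge> 1) \<and> enumerates ks (multi_indices N) \<longrightarrow>
      mat_rank (AZ_residual (A_cont p \<Omega> N ks) (Z_cont p N ks)) \<le> card (boundary_indices p \<Omega> N)"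
    using cont(2) by blast
  show "\<exists>C::real. \<forall>N ks. (\<forall>i. N i \<ge> 1) \<and> enumerates ks (multi_indices N) \<longrightarrow>
      real (card (large_rows \<delta> (AZ_residual (A_cont p \<Omega> N ks) (Z_cont p N ks))))
        \<le> C * real (card (boundary_indices p \<Omega> N))"
    using cont(3) by (intro exI[of _ "1 / \<delta>\<^sup>2"]) blast
  show "\<exists>C::real. \<forall>N ks. (\<forall>i. N i \<ge> 1) \<and> enumerates ks (multi_indices N) \<longrightarrow>
      real (card (large_entries \<delta> (AZ_residual (A_cont p \<Omega> N ks) (Z_cont p N ks))))
        \<le> C * real (card (boundary_indices p \<Omega> N))"
    using cont(4) by (intro exI[of _ "1 / \<delta>\<^sup>2"]) blast
next
  assume pq: "\<forall>i. q i \<ge> 1 \<and> discrete_dual_exists (p i) (q i)"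
  then have "\<And>i. q i \<ge> 1" "\<And>i. discrete_dual_exists (p i) (q i)" by auto
  note disc = discrete_residual_bounds[of \<delta> _ q p, OF assms(3) _ this]
  let ?C = "(\<Prod>i\<in>UNIV. real (q i)) / \<delta>\<^sup>2"
  show "\<forall>N ts ks. (\<forall>i. N i \<ge> 1) \<and> enumerates ts (grid q N \<inter> \<Omega>) \<and> enumerates ks (multi_indices N) \<longrightarrow>
      card (nonzero_cols (AZ_residual (A_disc p N ts ks) (Z_disc p q N ts ks)))
        \<le> card (discrete_boundary_indices p q \<Omega> N)"
    using disc(1) by blast
  show "\<forall>N ts ks. (\<forall>i. N i \<ge> 1) \<and> enumerates ts (grid q N \<inter> \<Omega>) \<and> enumerates ks (multi_indices N) \<longrightarrow>
      mat_rank (AZ_residual (A_disc p N ts ks) (Z_disc p q N ts ks))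
        \<le> card (discrete_boundary_indices p q \<Omega> N)"
    using disc(2) by blast
  show "\<exists>C::real. \<forall>N ts ks. (\<forall>i. N i \<ge> 1) \<and> enumerates ts (grid q N \<inter> \<Omega>)
        \<and> enumerates ks (multi_indices N) \<longrightarrow>
      real (card (large_rows \<delta> (AZ_residual (A_disc p N ts ks) (Z_disc p q N ts ks))))
        \<le> C * real (card (discrete_boundary_indices p q \<Omega> N))"
    using disc(3) by (intro exI[of _ ?C]) blast
  show "\<exists>C::real. \<forall>N ts ks. (\<forall>i. N i \<ge> 1) \<and> enumerates ts (grid q N \<inter> \<Omega>)
        \<and> enumerates ks (multi_indices N) \<longrightarrow>
      real (card (large_entries \<delta> (AZ_residual (A_disc p N ts ks) (Z_disc p q N ts ks))))
        \<le> C * real (card (discrete_boundary_indices p q \<Omega> N))"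
    using disc(4) by (intro exI[of _ ?C]) blast
qed

end
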